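(* Let $F:(0,1]\to\mathbb{R}_+$ be smooth and let $M,X,Y:(0,1]\to(0,1)$ be functions such that for all $0<\lambda\le 1$: $F'(\lambda)>0$, $X(\lambda)=\left(1-e^{-F'(\lambda)}\right)^{\frac{1}{1-M(\lambda)}}(1-M(\lambda))$, $(X(\lambda),Y(\lambda))\in\mathcal{R}$, and $$F(\lambda)>-\tfrac12\left(\log X(\lambda)+\lambda\log M(\lambda)+\lambda\log Y(\lambda)\right).$$ Then $R(k,\ell)\le e^{F(\ell/k)k+o(k)}$ for all positive integers $k\ge\ell$; that is, for every $\varepsilon>0$ there is $K$ such that $R(k,\ell)\le e^{(F(\ell/k)+\varepsilon)k}$ for all integers $k\ge K$ and $1\le\ell\le k$.
   Context: $R(k,\ell)$ denotes the two-color Ramsey number: the smallest $N$ such that every red-blue edge coloring of $K_N$ contains a complete subgraph on $k$ vertices with all edges red or a complete subgraph on $\ell$ vertices with all edges blue. Let $\mathcal{R}$ be the closure (in $\mathbb{R}^2$) of the set of all pairs $(x,y)\in(0,1)^2$ for which there exists $N_0$ such that $R(k,\ell)\le x^{-k}y^{-\ell}$ for all positive integers $k,\ell$ with $k+\ell\ge N_0$. *)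

theory Defs
  imports "HOL-Analysis.Analysis" "HOL-Library.Ramsey"
begin

text \<open>Colour \<open>0\<close> is red and colour \<open>1\<close> is blue; the edges of the complete graph on
  \<open>{..<N}\<close> are its two-element subsets.\<close>

definition ramsey_number :: "nat \<Rightarrow> nat \<Rightarrow> nat" where
  "ramsey_number k l = (LEAST N. partn_lst {..<N} [k, l] 2)"

lemma partn_lst_ramsey_number: "partn_lst {..<ramsey_number k l} [k, l] 2"
  unfolding ramsey_number_def by (rule LeastI_ex) (rule ramsey_full)

definition ramsey_region :: "(real \<times> real) set" where
  "ramsey_region = closure {(x, y). 0 < x \<and> x < 1 \<and> 0 < y \<and> y < 1 \<and>
     (\<exists>N0::nat. \<forall>k l. 1 \<le> k \<longrightarrow> 1 \<le> l \<longrightarrow> N0 \<le> k + l \<longrightarrow>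
        real (ramsey_number k l) \<le> x powi (- int k) * y powi (- int l))}"

text \<open>Derivatives are taken within \<open>S\<close>, hence one-sided at an endpoint of an interval;
  \<open>D n\<close> is the \<open>n\<close>-th derivative of \<open>f\<close> on \<open>S\<close>.\<close>

definition smooth_on :: "real set \<Rightarrow> (real \<Rightarrow> real) \<Rightarrow> bool" where
  "smooth_on S f \<longleftrightarrow>
     (\<exists>D :: nat \<Rightarrow> real \<Rightarrow> real. (\<forall>x\<in>S. D 0 x = f x) \<and>
        (\<forall>n. \<forall>x\<in>S. (D n has_real_derivative D (Suc n) x) (at x within S)))"

end

theory Submission
  imports Defs
begin

text \<open>
  Let \<open>d\<close> be the red density between vertex sets \<open>A\<close> and \<open>B\<close>, which may overlap. The proof follows
  the potential \<open>|A| |B| (d - p)^g\<close> for a large constant \<open>g\<close>. Replacing \<open>B\<close> by the red neighbourhood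
  in \<open>B\<close> of a typical vertex \<open>v\<close> of \<open>A\<close>, and \<open>A\<close> by the red or the blue neighbourhood of \<open>v\<close>,
  costs a factor \<open>p\<close> in \<open>|B|\<close> and does not decrease the average density, by Cauchy-Schwarz. If \<open>v\<close>
  has blue degree at most \<open>\<mu> |A|\<close> in \<open>A\<close>, weighted AM-GM shows that either the red choice loses at
  most a factor \<open>(1 - \<mu>) p^(1/(1 - \<mu>))\<close> of the potential or the blue choice loses at most a factor
  \<open>\<mu>\<close>, up to arbitrarily small errors. If many vertices of \<open>A\<close> have larger blue degree, they contain
  a blue clique of bounded size \<open>b\<close> whose common blue neighbourhood in \<open>A\<close> has size about
  \<open>\<mu>^b |A|\<close>. Once \<open>A\<close> is subexponentially small, \<open>B\<close> is still large enough for the bound provided by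
  the Ramsey region.

  For the theorem, fix \<open>k\<close> and induct on \<open>l\<close>. In a colouring without the two cliques every blue degree
  is below \<open>R(k, l - 1)\<close>, which by the mean value theorem is about \<open>exp (- F'(l/k))\<close> times the claimed
  bound for \<open>R(k, l)\<close>; hence the red density is about \<open>1 - exp (- F'(l/k))\<close>. Compactness makes the
  estimates uniform in \<open>l/k\<close> away from \<open>0\<close>, and near \<open>0\<close> the Erdos-Szekeres bound suffices.
\<close>

subsection \<open>Cliques and the Erdos-Szekeres bound\<close>

text \<open>One notion serves both colours, with \<open>E\<close> being \<open>red\<close> or its
  negation. The diagonal is exempt because \<open>red\<close> is irreflexive.\<close>

definition has_clique :: "('a \<Rightarrow> 'a \<Rightarrow> bool) \<Rightarrow> nat \<Rightarrow> 'a set \<Rightarrow> bool" where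
  "has_clique E k A \<longleftrightarrow> (\<exists>S\<in>nsets A k. \<forall>u\<in>S. \<forall>v\<in>S. u \<noteq> v \<longrightarrow> E u v)"

lemma has_clique_0 [simp]: "has_clique E 0 A"
  by (simp add: has_clique_def)

lemma has_clique_mono: "has_clique E k A \<Longrightarrow> A \<subseteq> B \<Longrightarrow> has_clique E k B"
  unfolding has_clique_def using nsets_mono[of A B k] by blast

lemma has_clique_decreasing:
  assumes "has_clique E k A" "j \<le> k"
  shows "has_clique E j A"
proof -
  from assms obtain S where S: "S \<subseteq> A" "finite S" "card S = k" "\<forall>u\<in>S. \<forall>v\<in>S. u \<noteq> v \<longrightarrow> E u v"
    by (auto simp: has_clique_def nsets_def)
  obtain T where "T \<subseteq> S" "card T = j"
    using obtain_subset_with_card_n[of j S] S assms by auto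
  then show ?thesis
    using S unfolding has_clique_def nsets_def by (auto intro!: exI[of _ T] intro: finite_subset)
qed

text \<open>Serves to attach a single vertex and, later, a whole blue clique to a clique in its
  common neighbourhood. The clause \<open>u \<noteq> v\<close> in the last hypothesis makes
  \<open>S\<close> disjoint from \<open>A\<close>, so the sizes add up.\<close>

lemma has_clique_Un:
  assumes "has_clique E k A" "S \<in> nsets B j" "\<forall>u\<in>S. \<forall>v\<in>S. u \<noteq> v \<longrightarrow> E u v"
    "\<forall>u\<in>S. \<forall>v\<in>A. u \<noteq> v \<and> E u v \<and> E v u"
  shows "has_clique E (k + j) (A \<union> B)"
proof -
  from assms(1) obtain T where T: "T \<subseteq> A" "finite T" "card T = k" "\<forall>u\<in>T. \<forall>v\<in>T. u \<noteq> v \<longrightarrow> E u v"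
    by (auto simp: has_clique_def nsets_def)
  have S: "S \<subseteq> B" "finite S" "card S = j"
    using assms(2) by (auto simp: nsets_def)
  have "w \<notin> S" if "w \<in> T" for w
  proof
    assume "w \<in> S"
    then have "w \<noteq> w"
      using assms(4) T(1) that by blast
    then show False by simp
  qed
  then have "T \<inter> S = {}"
    by blast
  then have "T \<union> S \<in> nsets (A \<union> B) (k + j)"
    using S T by (auto simp: nsets_def card_Un_disjoint)
  moreover have "\<forall>u\<in>T \<union> S. \<forall>v\<in>T \<union> S. u \<noteq> v \<longrightarrow> E u v"
    using T assms(3,4) by blast
  ultimately show ?thesis
    unfolding has_clique_def by blast
qed

lemma has_clique_insert:
  assumes "has_clique E k A" "\<forall>v\<in>A. x \<noteq> v \<and> E x v \<and> E v x"
  shows "has_clique E (Suc k) (insert x A)"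
  using has_clique_Un[OF assms(1), of "{x}" "{x}" 1] assms(2) by (simp add: nsets_def)

section \<open>Red graphs and their neighbourhoods\<close>

locale red_graph =
  fixes red :: "'a \<Rightarrow> 'a \<Rightarrow> bool"
  assumes red_sym: "red u v \<Longrightarrow> red v u"
    and red_irrefl [simp]: "\<not> red u u"
begin

abbreviation has_red :: "nat \<Rightarrow> 'a set \<Rightarrow> bool" where
  "has_red \<equiv> has_clique red"

abbreviation has_blue :: "nat \<Rightarrow> 'a set \<Rightarrow> bool" where
  "has_blue \<equiv> has_clique (\<lambda>u v. \<not> red u v)"

definition rednb :: "'a set \<Rightarrow> 'a \<Rightarrow> 'a set" where
  "rednb A x = {y\<in>A. red x y}"

text \<open>The vertex \<open>x\<close> has to be excluded explicitly since it is not red to itself;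
  this is the source of the \<open>Suc\<close> in \<open>card_nb\<close>.\<close>

definition bluenb :: "'a set \<Rightarrow> 'a \<Rightarrow> 'a set" where
  "bluenb A x = {y\<in>A. y \<noteq> x \<and> \<not> red x y}"

lemma finite_nb [simp]: "finite A \<Longrightarrow> finite (rednb A x)" "finite A \<Longrightarrow> finite (bluenb A x)"
  by (simp_all add: rednb_def bluenb_def)

lemma nb_subset: "rednb A x \<subseteq> A" "bluenb A x \<subseteq> A"
  by (auto simp: rednb_def bluenb_def)

lemma nb_partition:
  assumes "x \<in> A"
  shows "A = insert x (rednb A x \<union> bluenb A x)" "x \<notin> rednb A x \<union> bluenb A x"
    "rednb A x \<inter> bluenb A x = {}"
  using assms by (auto simp: rednb_def bluenb_def)

lemma card_nb:
  assumes "finite A" "x \<in> A"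
  shows "card A = Suc (card (rednb A x) + card (bluenb A x))"
proof -
  have "card (insert x (rednb A x \<union> bluenb A x)) = Suc (card (rednb A x) + card (bluenb A x))"
    using assms nb_partition(2,3)[OF assms(2)] by (simp add: card_Un_disjoint)
  then show ?thesis
    using arg_cong[OF nb_partition(1)[OF assms(2)], of card] by linarith
qed

lemma has_red_extend:
  assumes "has_red k (rednb A x)" "x \<in> A"
  shows "has_red (Suc k) A"
proof -
  have "has_red (Suc k) (insert x (rednb A x))"
    using assms(1) by (rule has_clique_insert) (auto simp: rednb_def intro: red_sym)
  then show ?thesis
    by (rule has_clique_mono) (use assms in \<open>auto simp: rednb_def\<close>)
qed

lemma has_blue_extend:
  assumes "has_blue k (bluenb A x)" "x \<in> A"
  shows "has_blue (Suc k) A"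
proof -
  have "has_blue (Suc k) (insert x (bluenb A x))"
    using assms(1) by (rule has_clique_insert) (auto simp: bluenb_def intro: red_sym)
  then show ?thesis
    by (rule has_clique_mono) (use assms in \<open>auto simp: bluenb_def\<close>)
qed

text \<open>Pascal's rule: if both neighbourhoods of a vertex missed their binomial bounds,
  \<open>A\<close> would be too small. The bound is slightly weaker than the classical one, which
  lets the induction start at \<open>k = 0\<close> or \<open>l = 0\<close>.\<close>

lemma erdos_szekeres:
  "finite A \<Longrightarrow> (k + l) choose l \<le> card A \<Longrightarrow> has_red k A \<or> has_blue l A"
proof (induction "k + l" arbitrary: k l A rule: less_induct)
  case less
  show ?case
  proof (cases "k = 0 \<or> l = 0")
    case True
    then show ?thesis by auto
  next
    case False
    then obtain k' l' where kl: "k = Suc k'" "l = Suc l'"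
      by (metis not0_implies_Suc)
    have ch: "(k + l) choose l = ((k' + l) choose l) + ((k + l') choose l')"
      by (simp add: kl)
    have "(k + l) choose l > 0"
      by simp
    then have "A \<noteq> {}"
      using less.prems by fastforce
    then obtain x where x: "x \<in> A" by blast
    have "card (rednb A x) \<ge> (k' + l) choose l \<or> card (bluenb A x) \<ge> (k + l') choose l'"
      using card_nb[OF less.prems(1) x] less.prems(2) ch by linarith
    then show ?thesis
    proof
      assume "card (rednb A x) \<ge> (k' + l) choose l"
      then have "has_red k' (rednb A x) \<or> has_blue l (rednb A x)"
        using less.hyps[of k' l "rednb A x"] less.prems kl by auto
      then show ?thesis
        using has_red_extend x has_clique_mono[OF _ nb_subset(1)] kl by blast
    next
      assume "card (bluenb A x) \<ge> (k + l') choose l'"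
      then have "has_red k (bluenb A x) \<or> has_blue l' (bluenb A x)"
        using less.hyps[of k l' "bluenb A x"] less.prems kl by auto
      then show ?thesis
        using has_blue_extend x has_clique_mono[OF _ nb_subset(2)] kl by blast
    qed
  qed
qed

section \<open>Ramsey numbers in terms of cliques of red graphs\<close>

lemma ramsey_number_clique:
  assumes "finite A" "ramsey_number k l \<le> card A"
  shows "has_red k A \<or> has_blue l A"
proof -
  define N where "N = ramsey_number k l"
  obtain h where h: "inj_on h {..<N}" "h ` {..<N} \<subseteq> A"
    using card_le_inj[of "{..<N}" A] assms by (auto simp: N_def)
  \<comment> \<open>The red graph is pulled back along \<open>h\<close>. The existential makes the
    colour a function of the unordered pair, and \<open>f2\<close> evaluates it by symmetry of
    \<open>red\<close>.\<close>
  define f :: "nat set \<Rightarrow> nat" where "f e = (if \<exists>u v. e = {u, v} \<and> red (h u) (h v) then 0 else 1)" for e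
  have f2: "f {u, v} = (if red (h u) (h v) then 0 else 1)" for u v
    unfolding f_def by (metis doubleton_eq_iff red_sym)
  have "f \<in> nsets {..<N} 2 \<rightarrow> {..<length [k, l]}"
    by (auto simp: f_def)
  then obtain i where i: "i < length [k, l]" "monochromatic {..<N} ([k, l] ! i) 2 f i"
    using partn_lst_ramsey_number[of k l] unfolding partn_lst_def N_def by blast
  then obtain H where H: "H \<in> nsets {..<N} ([k, l] ! i)" "f ` nsets H 2 \<subseteq> {i}"
    by (auto simp: monochromatic_def)
  have fi: "f {u, v} = i" if "u \<in> H" "v \<in> H" "u \<noteq> v" for u v
    using H(2) that by (auto simp: image_subset_iff)
  have HN: "H \<subseteq> {..<N}" "finite H" "card H = [k, l] ! i"
    using H by (auto simp: nsets_def)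
  have hH: "h ` H \<in> nsets A ([k, l] ! i)"
    using HN h card_image[OF inj_on_subset[OF h(1) HN(1)]] by (auto simp: nsets_def)
  have red_iff: "red (h u) (h v) \<longleftrightarrow> i = 0" if "u \<in> H" "v \<in> H" "h u \<noteq> h v" for u v
    using fi[of u v] f2[of u v] that by (auto split: if_splits)
  from i have "i = 0 \<or> i = 1" by auto
  then show ?thesis
  proof
    assume "i = 0"
    then have "has_red k A"
      unfolding has_clique_def using hH red_iff by (intro bexI[of _ "h ` H"]) auto
    then show ?thesis ..
  next
    assume "i = 1"
    then have "has_blue l A"
      unfolding has_clique_def using hH red_iff by (intro bexI[of _ "h ` H"]) auto
    then show ?thesis ..
  qed
qed

end

text \<open>The pairs of colour \<open>0\<close> form a red graph, so finding cliques in every red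
  graph handles every colouring.\<close>

lemma ramsey_number_leI:
  assumes "\<And>red :: nat \<Rightarrow> nat \<Rightarrow> bool. red_graph red \<Longrightarrow>
     has_clique red k {..<N} \<or> has_clique (\<lambda>u v. \<not> red u v) l {..<N}"
  shows "ramsey_number k l \<le> N"
  unfolding ramsey_number_def
proof (rule Least_le)
  show "partn_lst {..<N} [k, l] 2"
    unfolding partn_lst_def
  proof (rule ballI)
    fix f :: "nat set \<Rightarrow> nat"
    assume f: "f \<in> nsets {..<N} 2 \<rightarrow> {..<length [k, l]}"
    define red where "red u v \<longleftrightarrow> u \<noteq> v \<and> f {u, v} = 0" for u v
    have "red_graph red"
      by standard (auto simp: red_def insert_commute)
    from assms[OF this] show "\<exists>i<length [k, l]. monochromatic {..<N} ([k, l] ! i) 2 f i"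
    proof
      assume "has_clique red k {..<N}"
      then obtain S where S: "S \<in> nsets {..<N} k" "\<forall>u\<in>S. \<forall>v\<in>S. u \<noteq> v \<longrightarrow> red u v"
        by (auto simp: has_clique_def)
      have "f e = 0" if "e \<in> nsets S 2" for e
        using that S(2) by (auto elim!: nsets2_E simp: red_def)
      then have "monochromatic {..<N} ([k, l] ! 0) 2 f 0"
        unfolding monochromatic_def using S by (auto intro!: bexI[of _ S])
      then show ?thesis by (intro exI[of _ 0]) auto
    next
      assume "has_clique (\<lambda>u v. \<not> red u v) l {..<N}"
      then obtain S where S: "S \<in> nsets {..<N} l" "\<forall>u\<in>S. \<forall>v\<in>S. u \<noteq> v \<longrightarrow> \<not> red u v"
        by (auto simp: has_clique_def)
      \<comment> \<open>Colours are confined to \<open>0\<close> and \<open>1\<close> only on pairs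
        inside \<open>{..<N}\<close>, so the pair has to be placed there before "not red" can mean
        "blue".\<close>
      have "f e = 1" if e: "e \<in> nsets S 2" for e
      proof -
        obtain u v where uv: "e = {u, v}" "u \<in> S" "v \<in> S" "u \<noteq> v"
          using e by (rule nsets2_E)
        have "S \<subseteq> {..<N}" using S(1) by (simp add: nsets_def)
        then have "e \<in> nsets {..<N} 2" using uv by auto
        then have "f e < length [k, l]" using f by (meson Pi_mem lessThan_iff)
        then have "f e < 2" by simp
        moreover have "f e \<noteq> 0"
          using S(2) uv by (auto simp: red_def)
        ultimately show ?thesis by linarith
      qed
      then have "monochromatic {..<N} ([k, l] ! 1) 2 f 1"
        unfolding monochromatic_def using S by (auto intro!: bexI[of _ S])
      then show ?thesis by (intro exI[of _ 1]) auto
    qed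
  qed
qed

lemma ramsey_number_le_binomial: "ramsey_number k l \<le> (k + l) choose l"
  by (rule ramsey_number_leI) (simp add: red_graph.erdos_szekeres)

subsection \<open>Numerical and averaging estimates\<close>

lemma exp_minus_le_quadratic:
  fixes z :: real
  assumes "0 \<le> z"
  shows "exp (- z) \<le> 1 - z + z\<^sup>2"
proof -
  have "exp (- z) \<le> 1 / (1 + z)"
    using assms exp_ge_add_one_self[of z] by (simp add: exp_minus inverse_eq_divide frac_le)
  also have "\<dots> \<le> 1 - z + z\<^sup>2"
  proof -
    have "(1 - z + z\<^sup>2) * (1 + z) = 1 + z ^ 3"
      by (simp add: algebra_simps power2_eq_square power3_eq_cube)
    then have "1 \<le> (1 - z + z\<^sup>2) * (1 + z)"
      using assms by simp
    then show ?thesis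
      using assms by (simp add: pos_divide_le_eq)
  qed
  finally show ?thesis .
qed

text \<open>Write \<open>r * s\<close> as the product of \<open>r powr (1 - 1/g)\<close> and
  \<open>(r * s ^ g) powr (1/g)\<close>, bound the second factor by hypothesis, and apply weighted
  AM-GM to \<open>r\<close> and \<open>a\<close>.\<close>

lemma young_power_step:
  fixes r s a u :: real
  assumes "0 < r" "0 \<le> s" "0 < a" "0 < g" "r * s ^ g \<le> a * exp u"
  shows "r * s \<le> exp (u / g) * ((1 - 1 / g) * r + (1 / g) * a)"
proof -
  define \<theta> where "\<theta> = 1 / real g"
  have \<theta>: "0 < \<theta>" "\<theta> \<le> 1" using assms by (auto simp: \<theta>_def)
  have "s ^ g \<le> a * exp u / r"
    using assms by (simp add: field_simps)
  then have "(s ^ g) powr \<theta> \<le> (a * exp u / r) powr \<theta>"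
    using \<theta> assms by (intro powr_mono2) auto
  moreover have "(s ^ g) powr \<theta> = s"
  proof (cases "s = 0")
    case False
    then have "(s ^ g) powr \<theta> = s powr (g * \<theta>)"
      using assms by (simp add: powr_powr flip: powr_realpow)
    then show ?thesis using assms False by (simp add: \<theta>_def)
  qed (use assms in simp)
  moreover have "(a * exp u / r) powr \<theta> = a powr \<theta> * exp (u * \<theta>) / r powr \<theta>"
    using assms by (simp add: powr_divide powr_mult exp_powr_real)
  ultimately have "s \<le> a powr \<theta> * exp (u * \<theta>) / r powr \<theta>" by simp
  then have "r * s \<le> r * (a powr \<theta> * exp (u * \<theta>) / r powr \<theta>)"
    using assms(1) by (intro mult_left_mono) auto
  also have "\<dots> = exp (u * \<theta>) * (r powr (1 - \<theta>) * a powr \<theta>)"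
    using assms by (simp add: powr_diff)
  also have "\<dots> \<le> exp (u * \<theta>) * ((1 - \<theta>) * r + \<theta> * a)"
    using Youngs_inequality_0[of "1 - \<theta>" \<theta> r a] \<theta> assms by simp
  finally show ?thesis by (simp add: \<theta>_def)
qed

text \<open>Here \<open>r\<close> and \<open>b\<close> are the relative sizes of the red and blue
  neighbourhoods, and \<open>s\<close> and \<open>t\<close> the ratios of new to old excess. If both
  alternatives fail, \<open>young_power_step\<close> bounds \<open>r * s\<close> and
  \<open>b * t\<close>, and their sum falls below \<open>1 - \<zeta>\<close>. By the choice of
  \<open>\<kappa>\<close>, \<open>p = exp (- \<kappa> * (1 - \<mu>))\<close>, so the red bound
  carries \<open>exp (- \<mu> * \<kappa>)\<close> and the blue one
  \<open>exp ((1 - \<mu>) * \<kappa>)\<close>; with weights \<open>1 - \<mu>\<close> and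
  \<open>\<mu>\<close> these cancel to first order, and the gain \<open>exp (- \<eta>)\<close> beats
  the second-order rest once \<open>g\<close> is large.\<close>

lemma step_dichotomy:
  fixes p \<mu> \<eta> \<zeta> \<kappa> r b s t :: real and g :: nat
  assumes p: "0 < p" "p < 1" and \<mu>: "0 < \<mu>" "\<mu> < 1" and "0 < \<eta>" and g: "0 < g"
    and \<kappa>: "\<kappa> = - ln p / (1 - \<mu>)"
    and small: "2 * \<eta> \<le> g" "4 * \<kappa>\<^sup>2 \<le> \<eta> * g" "\<kappa> \<le> g" "\<zeta> < \<eta> / (2 * g)"
    and rb: "0 \<le> r" "0 \<le> b" "r + b \<le> 1" "b \<le> \<mu>" and avg: "1 - \<zeta> \<le> r * s + b * t"
  shows "(0 < r \<and> 0 < s \<and> r * p * s ^ g \<ge> (1 - \<mu>) * p powr (1 / (1 - \<mu>)) * exp (- \<eta>)) \<or>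
         (0 < b \<and> 0 < t \<and> b * p * t ^ g \<ge> \<mu> * exp (- \<eta>))"
proof (rule ccontr)
  assume contra: "\<not> ?thesis"
  define \<theta> where "\<theta> = 1 / real g"
  define \<tau> where "\<tau> = \<kappa> * \<theta>"
  define z where "z = \<eta> * \<theta>"
  \<comment> \<open>The mean of \<open>b\<close> and \<open>\<mu>\<close> that AM-GM produces on the
    blue side; on the red side \<open>r \<le> 1 - b\<close> gives the complementary
    \<open>1 - b'\<close>.\<close>
  define b' where "b' = (1 - \<theta>) * b + \<theta> * \<mu>"
  have \<theta>: "0 < \<theta>" "\<theta> \<le> 1" using g by (auto simp: \<theta>_def)
  have \<kappa>0: "0 < \<kappa>" using p \<mu> by (simp add: \<kappa> field_simps)
  have lnp: "ln p = - \<kappa> * (1 - \<mu>)" using \<mu> by (simp add: \<kappa>)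
  have \<tau>: "0 < \<tau>" "\<tau> \<le> 1" using \<kappa>0 \<theta> small g by (auto simp: \<tau>_def \<theta>_def)
  have z: "0 < z" "z \<le> 1 / 2"
    using \<open>0 < \<eta>\<close> \<theta>(1) small(1) g by (simp_all add: z_def \<theta>_def divide_le_eq)
  have \<tau>z: "\<tau>\<^sup>2 \<le> z / 4"
    using small(2) g by (simp add: \<tau>_def z_def \<theta>_def field_simps power2_eq_square)
  have b': "0 \<le> b'" "b' \<le> \<mu>"
  proof -
    show "0 \<le> b'" using rb \<theta> \<mu> by (simp add: b'_def)
    have "(1 - \<theta>) * b \<le> (1 - \<theta>) * \<mu>" using rb \<theta> by (intro mult_left_mono) auto
    then show "b' \<le> \<mu>" by (simp add: b'_def algebra_simps)
  qed
  have red_le: "r * s \<le> exp (- z) * exp (- \<mu> * \<tau>) * (1 - b')"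
  proof (cases "0 < r \<and> 0 < s")
    case True
    then have "r * p * s ^ g \<le> (1 - \<mu>) * p powr (1 / (1 - \<mu>)) * exp (- \<eta>)"
      using contra by auto
    also have "p powr (1 / (1 - \<mu>)) = p * exp (- \<mu> * \<kappa>)"
    proof -
      have "p powr (1 / (1 - \<mu>)) = exp (- \<kappa>)"
        using p \<mu> by (simp add: powr_def \<kappa>)
      also have "\<dots> = exp (ln p) * exp (- \<mu> * \<kappa>)"
        unfolding lnp by (simp add: algebra_simps flip: exp_add)
      finally show ?thesis using p by simp
    qed
    finally have "r * s ^ g * p \<le> (1 - \<mu>) * exp (- \<eta> - \<mu> * \<kappa>) * p"
      by (simp add: exp_diff exp_minus field_simps)
    then have "r * s ^ g \<le> (1 - \<mu>) * exp (- \<eta> - \<mu> * \<kappa>)"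
      using p by simp
    from young_power_step[OF _ _ _ g this] True \<mu>
    have "r * s \<le> exp ((- \<eta> - \<mu> * \<kappa>) * \<theta>) * ((1 - \<theta>) * r + \<theta> * (1 - \<mu>))"
      by (simp add: \<theta>_def)
    also have "(- \<eta> - \<mu> * \<kappa>) * \<theta> = - z + - \<mu> * \<tau>"
      by (simp add: z_def \<tau>_def algebra_simps)
    also have "exp (- z + - \<mu> * \<tau>) * ((1 - \<theta>) * r + \<theta> * (1 - \<mu>)) \<le> exp (- z + - \<mu> * \<tau>) * (1 - b')"
    proof (rule mult_left_mono)
      have "(1 - \<theta>) * r \<le> (1 - \<theta>) * (1 - b)"
        using rb \<theta> by (intro mult_left_mono) auto
      then show "(1 - \<theta>) * r + \<theta> * (1 - \<mu>) \<le> 1 - b'"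
        by (simp add: b'_def algebra_simps)
    qed simp
    finally show ?thesis by (simp only: exp_add)
  next
    case False
    then have "r * s \<le> 0" using rb by (auto simp: mult_nonneg_nonpos not_less)
    also have "0 \<le> exp (- z) * exp (- \<mu> * \<tau>) * (1 - b')" using b' \<mu> by simp
    finally show ?thesis .
  qed
  have blue_le: "b * t \<le> exp (- z) * exp ((1 - \<mu>) * \<tau>) * b'"
  proof (cases "0 < b \<and> 0 < t")
    case True
    then have "b * p * t ^ g \<le> \<mu> * exp (- \<eta>)"
      using contra by auto
    also have "\<dots> = \<mu> * exp (- \<eta> + (1 - \<mu>) * \<kappa>) * exp (ln p)"
      unfolding lnp by (simp add: algebra_simps flip: exp_add)
    finally have "b * t ^ g * p \<le> \<mu> * exp (- \<eta> + (1 - \<mu>) * \<kappa>) * p"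
      using p by (simp add: mult_ac)
    then have "b * t ^ g \<le> \<mu> * exp (- \<eta> + (1 - \<mu>) * \<kappa>)"
      using p by simp
    from young_power_step[OF _ _ _ g this] True \<mu>
    have "b * t \<le> exp ((- \<eta> + (1 - \<mu>) * \<kappa>) * \<theta>) * b'"
      by (simp add: \<theta>_def b'_def)
    also have "(- \<eta> + (1 - \<mu>) * \<kappa>) * \<theta> = - z + (1 - \<mu>) * \<tau>"
      by (simp add: z_def \<tau>_def algebra_simps)
    finally show ?thesis by (simp only: exp_add)
  next
    case False
    then have "b * t \<le> 0" using rb by (auto simp: mult_nonneg_nonpos not_less)
    also have "0 \<le> exp (- z) * exp ((1 - \<mu>) * \<tau>) * b'" using b' by simp
    finally show ?thesis .
  qed
  define P where "P = exp (- \<mu> * \<tau>)"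
  define R where "R = exp ((1 - \<mu>) * \<tau>)"
  have P: "P \<le> 1 - \<mu> * \<tau> + (\<mu> * \<tau>)\<^sup>2"
    using exp_minus_le_quadratic[of "\<mu> * \<tau>"] \<mu> \<tau> by (simp add: P_def)
  have R: "R \<le> 1 + (1 - \<mu>) * \<tau> + ((1 - \<mu>) * \<tau>)\<^sup>2"
    unfolding R_def using \<mu> \<tau> by (intro exp_bound) (auto intro: mult_le_one)
  have "P \<le> 1" using \<mu> \<tau> by (simp add: P_def)
  moreover have "1 \<le> R" using \<mu> \<tau> by (simp add: R_def)
  \<comment> \<open>Because \<open>P \<le> R\<close>, the worst case is \<open>b' = \<mu>\<close>.
    There the terms linear in \<open>\<tau>\<close> cancel and only
    \<open>\<mu> * (1 - \<mu>) * \<tau>\<^sup>2\<close> remains.\<close>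
  ultimately have "b' * (R - P) \<le> \<mu> * (R - P)"
    using b' by (intro mult_right_mono) auto
  then have "P * (1 - b') + R * b' \<le> (1 - \<mu>) * P + \<mu> * R"
    by (simp add: algebra_simps)
  also have "\<dots> \<le> (1 - \<mu>) * (1 - \<mu> * \<tau> + (\<mu> * \<tau>)\<^sup>2) + \<mu> * (1 + (1 - \<mu>) * \<tau> + ((1 - \<mu>) * \<tau>)\<^sup>2)"
    using P R \<mu> by (intro add_mono mult_left_mono) auto
  also have "\<dots> = 1 + \<mu> * (1 - \<mu>) * \<tau>\<^sup>2"
    by (simp add: algebra_simps power2_eq_square)
  also have "\<dots> \<le> 1 + 1 * \<tau>\<^sup>2"
    using \<mu> by (intro add_left_mono mult_right_mono) (auto intro: mult_le_one)
  also have "\<dots> \<le> 1 + z / 4" using \<tau>z by simp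
  finally have PR: "P * (1 - b') + R * b' \<le> 1 + z / 4" .
  have "1 - \<zeta> \<le> exp (- z) * P * (1 - b') + exp (- z) * R * b'"
    using avg red_le blue_le by (simp add: P_def R_def)
  also have "\<dots> = exp (- z) * (P * (1 - b') + R * b')"
    by (simp add: algebra_simps)
  also have "\<dots> \<le> exp (- z) * (1 + z / 4)"
    using PR by simp
  also have "\<dots> \<le> (1 / (1 + z)) * (1 + z / 4)"
    using z exp_ge_add_one_self[of z]
    by (intro mult_right_mono) (auto simp: exp_minus inverse_eq_divide frac_le)
  also have "\<dots> \<le> 1 - z / 2"
  proof -
    have "z * z \<le> z * (1 / 2)" using z by (intro mult_left_mono) auto
    moreover have "(1 - z / 2) * (1 + z) = 1 + z / 2 - z * z / 2"
      by (simp add: field_simps)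
    ultimately have "1 + z / 4 \<le> (1 - z / 2) * (1 + z)"
      by linarith
    then show ?thesis using z by (simp add: pos_divide_le_eq)
  qed
  finally have "z / 2 \<le> \<zeta>" by simp
  then show False using small(4) g by (simp add: z_def \<theta>_def)
qed

section \<open>Sets with a large common intersection\<close>

lemma fact_binomial_ge:
  assumes "d \<le> m"
  shows "real m * d ^ b - b\<^sup>2 * real m ^ b \<le> m * (fact b * real (d choose b))"
proof (induction b)
  case (Suc b)
  define X where "X = fact b * real (d choose b)"
  have "real (Suc b) * real (d choose Suc b) = (real d - real b) * real (d choose b)"
  proof (cases "b \<le> d")
    case True
    have "Suc b * (d choose Suc b) = (d - b) * (d choose b)"
      by (simp only: binomial_absorption binomial_absorb_comp)
    then show ?thesis using True by (metis of_nat_diff of_nat_mult)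
  qed (simp add: binomial_eq_0)
  then have "fact b * (real (Suc b) * real (d choose Suc b)) = fact b * ((real d - real b) * real (d choose b))"
    by simp
  then have eq: "fact (Suc b) * real (d choose Suc b) = (real d - real b) * X"
    by (simp only: X_def fact_Suc mult_ac)
  have "(d choose b) * fact b \<le> d ^ b"
    by (rule binomial_fact_pow)
  then have "X \<le> real (d ^ b)"
    unfolding X_def by (metis mult.commute of_nat_fact of_nat_le_iff of_nat_mult)
  also have "\<dots> \<le> real m ^ b"
    using assms by (simp add: power_mono)
  finally have Xm: "X \<le> real m ^ b" .
  have "real d * (real m * d ^ b - b\<^sup>2 * real m ^ b) \<le> real d * (m * X)"
    using Suc by (intro mult_left_mono) (auto simp: X_def)
  moreover have "real m * b * X \<le> real m * b * real m ^ b"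
    using Xm by (intro mult_left_mono) auto
  moreover have "real d * (b\<^sup>2 * real m ^ b) \<le> real m * (b\<^sup>2 * real m ^ b)"
    using assms by (intro mult_right_mono) auto
  \<comment> \<open>The left side of the claim approximates a falling factorial; the new factor
    \<open>d - b\<close> raises the error coefficient from \<open>b\<^sup>2\<close> to at most
    \<open>b\<^sup>2 + b\<close>. The factor \<open>m\<close> throughout avoids the exponent
    \<open>b - 1\<close>.\<close>
  ultimately have "real m * d ^ Suc b - (b\<^sup>2 + b) * real m ^ Suc b \<le> m * ((real d - real b) * X)"
    by (simp add: algebra_simps)
  moreover have "(real b ^ 2 + b) * real m ^ Suc b \<le> (real (Suc b))\<^sup>2 * real m ^ Suc b"
    by (intro mult_right_mono) (auto simp: power2_eq_square algebra_simps)
  ultimately show ?case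
    unfolding eq by simp
qed simp

text \<open>Bernoulli's inequality at \<open>x / a - 1\<close>. Summed over many \<open>x\<close> it
  gives Jensen's inequality; \<open>a ^ b / a\<close> replaces \<open>a ^ (b - 1)\<close>.\<close>

lemma power_tangent_le:
  fixes a x :: real
  assumes "0 < a" "0 \<le> x"
  shows "a ^ b + b * (a ^ b / a) * (x - a) \<le> x ^ b"
proof -
  have "1 + b * (x / a - 1) \<le> (1 + (x / a - 1)) ^ b"
    using assms by (intro Bernoulli_inequality) auto
  then have "a ^ b * (1 + b * (x / a - 1)) \<le> a ^ b * (x / a) ^ b"
    using assms by simp
  also have "\<dots> = x ^ b" using assms by (simp flip: power_mult_distrib)
  finally show ?thesis using assms by (simp add: field_simps)
qed

text \<open>Averaging over all \<open>b\<close>-subsets \<open>S\<close> of \<open>T\<close>: the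
  pairs of such an \<open>S\<close> and a common element \<open>v\<close> number the sum of
  \<open>d v choose b\<close>, where \<open>d v\<close> counts the sets containing \<open>v\<close>.
  Convexity bounds this sum from below, and the size of \<open>T\<close> makes the difference
  between powers and falling factorials harmless.\<close>

lemma common_intersection:
  fixes A :: "'a \<Rightarrow> 'b set" and \<mu> :: real
  assumes fin: "finite X" "finite T" and sub: "\<And>u. u \<in> T \<Longrightarrow> A u \<subseteq> X"
    and large: "\<And>u. u \<in> T \<Longrightarrow> \<mu> * card X \<le> card (A u)"
    and \<mu>: "0 < \<mu>" "\<mu> < 1" and b: "1 \<le> b" "2 * real b ^ 2 \<le> \<mu> ^ b * card T"
  shows "\<exists>S\<in>nsets T b. \<mu> ^ b / 2 * card X \<le> card {v\<in>X. \<forall>u\<in>S. v \<in> A u}"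
proof (rule ccontr)
  assume contra: "\<not> ?thesis"
  define m where "m = card T"
  define n where "n = card X"
  define d where "d v = card {u\<in>T. v \<in> A u}" for v
  have "\<mu> ^ b \<le> 1" using \<mu> by (simp add: power_le_one)
  then have "\<mu> ^ b * m \<le> 1 * real m" by (intro mult_right_mono) auto
  then have "2 * real b ^ 2 \<le> m" using b by (simp add: m_def)
  moreover have "real b \<le> real b ^ 2" using b by (simp add: power2_eq_square)
  ultimately have bm: "b \<le> m" using b(1) by linarith
  then have m0: "0 < m" using b by simp
  have ne: "nsets T b \<noteq> {}"
    using bm fin by (simp add: nsets_eq_empty_iff m_def)
  have finT: "finite (nsets T b)" using fin by (simp add: finite_imp_finite_nsets)
  have dm: "d v \<le> m" for v unfolding d_def m_def using fin by (intro card_mono) auto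
  have "(\<Sum>S\<in>nsets T b. card {v\<in>X. \<forall>u\<in>S. v \<in> A u}) = (\<Sum>v\<in>X. card {S\<in>nsets T b. \<forall>u\<in>S. v \<in> A u})"
    by (rule sum_multicount_gen) (use fin finT in auto)
  also have "\<dots> = (\<Sum>v\<in>X. d v choose b)"
  proof (rule sum.cong)
    fix v
    have "{S\<in>nsets T b. \<forall>u\<in>S. v \<in> A u} = nsets {u\<in>T. v \<in> A u} b"
      by (auto simp: nsets_def)
    then show "card {S\<in>nsets T b. \<forall>u\<in>S. v \<in> A u} = d v choose b"
      by (simp add: d_def)
  qed simp
  finally have count: "(\<Sum>S\<in>nsets T b. card {v\<in>X. \<forall>u\<in>S. v \<in> A u}) = (\<Sum>v\<in>X. d v choose b)" .
  have "(\<Sum>v\<in>X. d v) = (\<Sum>u\<in>T. card {v\<in>X. v \<in> A u})"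
    unfolding d_def by (rule sum_multicount_gen) (use fin in auto)
  also have "\<dots> = (\<Sum>u\<in>T. card (A u))"
    using sub by (intro sum.cong refl arg_cong[of _ _ card]) auto
  finally have "real (\<Sum>v\<in>X. d v) = (\<Sum>u\<in>T. real (card (A u)))" by simp
  also have "\<dots> \<ge> (\<Sum>u\<in>T. \<mu> * n)" using large by (intro sum_mono) (auto simp: n_def)
  finally have dsum: "\<mu> * m * n \<le> (\<Sum>v\<in>X. real (d v))" by (simp add: m_def mult_ac)
  define a where "a = \<mu> * m"
  have a0: "0 < a" using \<mu> m0 by (simp add: a_def)
  \<comment> \<open>Jensen: the mean of \<open>d v\<close> is at least \<open>a = \<mu> * m\<close>,
    so the linear term of the tangent has a nonnegative sum.\<close>
  have "n * a ^ b \<le> n * a ^ b + b * (a ^ b / a) * ((\<Sum>v\<in>X. real (d v)) - n * a)"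
    using dsum a0 by (simp add: a_def mult_ac)
  also have "\<dots> = (\<Sum>v\<in>X. a ^ b + b * (a ^ b / a) * (d v - a))"
    by (simp only: sum.distrib sum_subtractf sum_distrib_left[symmetric] sum_constant n_def)
  also have "\<dots> \<le> (\<Sum>v\<in>X. real (d v) ^ b)"
    using a0 by (intro sum_mono power_tangent_le) auto
  finally have pm: "n * a ^ b \<le> (\<Sum>v\<in>X. real (d v) ^ b)" .
  have "m * (n * a ^ b) - n * (b\<^sup>2 * real m ^ b) \<le> m * (\<Sum>v\<in>X. real (d v) ^ b) - n * (b\<^sup>2 * real m ^ b)"
    using pm by (simp add: mult_left_mono)
  also have "\<dots> = (\<Sum>v\<in>X. real m * d v ^ b - b\<^sup>2 * real m ^ b)"
    by (simp add: sum_subtractf sum_distrib_left n_def)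
  also have "\<dots> \<le> (\<Sum>v\<in>X. m * (fact b * real (d v choose b)))"
    using fact_binomial_ge[OF dm] by (intro sum_mono) simp
  also have "\<dots> = m * (fact b * real (\<Sum>v\<in>X. d v choose b))"
    by (simp add: sum_distrib_left)
  also have "\<dots> = m * (fact b * (\<Sum>S\<in>nsets T b. real (card {v\<in>X. \<forall>u\<in>S. v \<in> A u})))"
    by (simp flip: count)
  also have "\<dots> < m * (fact b * (\<Sum>S\<in>nsets T b. \<mu> ^ b / 2 * n))"
    using contra m0 ne finT
    by (intro mult_strict_left_mono sum_strict_mono) (auto simp: n_def not_le)
  also have "\<dots> = m * (\<mu> ^ b / 2 * n) * real ((m choose b) * fact b)"
    by (simp add: m_def)
  also have "\<dots> \<le> m * (\<mu> ^ b / 2 * n) * real (m ^ b)"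
    using \<mu> binomial_fact_pow by (intro mult_left_mono) (auto simp del: of_nat_mult)
  finally have "m * (n * a ^ b) - n * (b\<^sup>2 * real m ^ b) < m * (\<mu> ^ b / 2 * n) * real m ^ b"
    by simp
  then have "m * (n * \<mu> ^ b) * real m ^ b < (n * b\<^sup>2 + m * (\<mu> ^ b / 2 * n)) * real m ^ b"
    by (simp add: a_def power_mult_distrib algebra_simps)
  then have "m * (n * \<mu> ^ b) < n * b\<^sup>2 + m * (\<mu> ^ b / 2 * n)"
    by (simp add: mult_less_cancel_right)
  \<comment> \<open>By the size of \<open>T\<close>, the error \<open>n * b\<^sup>2\<close> is at
    most half of the main term; the assumed upper bound covers only the other half.\<close>
  moreover have "n * (2 * real b ^ 2) \<le> n * (\<mu> ^ b * m)"
    using b by (intro mult_left_mono) (auto simp: m_def)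
  ultimately show False
    by (simp add: field_simps)
qed

section \<open>Excess of red edges between two vertex sets\<close>

context red_graph
begin

text \<open>The number of ordered red pairs in \<open>A\<close> times \<open>B\<close> beyond the
  \<open>p\<close>-fraction of all pairs. Unlike the density it is additive in \<open>A\<close>,
  which the step from \<open>X\<close> to the two neighbourhoods of a vertex exploits.\<close>

definition excess :: "real \<Rightarrow> 'a set \<Rightarrow> 'a set \<Rightarrow> real" where
  "excess p A B = (\<Sum>a\<in>A. real (card (rednb B a)) - p * real (card B))"

lemma excess_Un:
  assumes "finite A" "finite A'" "A \<inter> A' = {}"
  shows "excess p (A \<union> A') B = excess p A B + excess p A' B"
  unfolding excess_def using assms by (rule sum.union_disjoint)

lemma excess_nb:
  fixes p :: real
  assumes "finite X" "x \<in> X"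
  shows "excess p X B = card (rednb B x) - p * card B + excess p (rednb X x) B + excess p (bluenb X x) B"
proof -
  note part = nb_partition[OF assms(2)]
  have "excess p (insert x (rednb X x \<union> bluenb X x)) B =
      card (rednb B x) - p * card B + excess p (rednb X x \<union> bluenb X x) B"
    using assms part(2) unfolding excess_def by (subst sum.insert) auto
  also have "excess p (rednb X x \<union> bluenb X x) B = excess p (rednb X x) B + excess p (bluenb X x) B"
    using assms part(3) by (intro excess_Un) auto
  finally show ?thesis
    using arg_cong[OF part(1), of "\<lambda>Z. excess p Z B"] by linarith
qed

lemma excess_le:
  assumes "finite B" "0 \<le> p"
  shows "excess p A B \<le> real (card A) * card B"
proof -
  have "excess p A B \<le> (\<Sum>a\<in>A. real (card B))"
    unfolding excess_def
  proof (rule sum_mono)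
    fix a
    have "card (rednb B a) \<le> card B" using assms nb_subset by (simp add: card_mono)
    moreover have "0 \<le> p * card B" using assms by simp
    ultimately show "card (rednb B a) - p * card B \<le> real (card B)" by linarith
  qed
  then show ?thesis by simp
qed

text \<open>Counting common red neighbours in \<open>Y\<close> over all pairs from \<open>X\<close>
  gives the sum of the squared degrees \<open>d y\<close>. By Cauchy-Schwarz, passing from
  \<open>Y\<close> to \<open>rednb Y x\<close> therefore does not lower the density seen from
  \<open>X\<close>, on average over \<open>x\<close> with weight
  \<open>card (rednb Y x)\<close>.\<close>

lemma sum_excess_rednb_ge:
  fixes p e :: real
  assumes fin: "finite X" "finite Y" and Y: "Y \<noteq> {}" and e: "excess p X Y = e * card X * card Y"
  shows "0 \<le> (\<Sum>x\<in>X. excess p X (rednb Y x) - e * card X * card (rednb Y x))"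
proof -
  define n where "n = real (card X)"
  define c where "c = real (card Y)"
  define d where "d y = (\<Sum>x\<in>X. of_bool (red x y) :: real)" for y
  define D where "D = (\<Sum>y\<in>Y. d y)"
  have c0: "0 < c" using Y fin by (simp add: c_def card_gt_0_iff)
  have card1: "real (card (rednb Y x)) = (\<Sum>y\<in>Y. of_bool (red x y))" for x
  proof -
    have "rednb Y x = Y \<inter> {y. red x y}" by (auto simp: rednb_def)
    then show ?thesis using fin by simp
  qed
  have card2: "real (card (rednb (rednb Y x) a)) = (\<Sum>y\<in>Y. of_bool (red x y) * of_bool (red a y))" for x a
  proof -
    have "rednb (rednb Y x) a = Y \<inter> {y. red x y \<and> red a y}" by (auto simp: rednb_def)
    then show ?thesis using fin by (simp flip: of_bool_conj)
  qed
  have D: "(\<Sum>x\<in>X. real (card (rednb Y x))) = D"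
    unfolding card1 D_def d_def by (rule sum.swap)
  have sq: "(\<Sum>x\<in>X. \<Sum>a\<in>X. real (card (rednb (rednb Y x) a))) = (\<Sum>y\<in>Y. (d y)\<^sup>2)"
  proof -
    have "(\<Sum>x\<in>X. \<Sum>a\<in>X. real (card (rednb (rednb Y x) a))) =
        (\<Sum>x\<in>X. \<Sum>y\<in>Y. \<Sum>a\<in>X. of_bool (red x y) * of_bool (red a y))"
      unfolding card2 by (intro sum.cong refl sum.swap)
    also have "\<dots> = (\<Sum>y\<in>Y. \<Sum>x\<in>X. \<Sum>a\<in>X. of_bool (red x y) * of_bool (red a y))"
      by (rule sum.swap)
    also have "\<dots> = (\<Sum>y\<in>Y. (d y)\<^sup>2)"
      unfolding d_def power2_eq_square sum_product ..
    finally show ?thesis .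
  qed
  have De: "D = (p + e) * n * c"
  proof -
    have "excess p X Y = D - p * c * n"
      unfolding excess_def by (simp add: sum_subtractf D c_def n_def)
    then show ?thesis using e by (simp add: n_def c_def algebra_simps)
  qed
  have "(\<Sum>x\<in>X. excess p X (rednb Y x) - e * card X * card (rednb Y x))
      = (\<Sum>x\<in>X. (\<Sum>a\<in>X. real (card (rednb (rednb Y x) a))) - (p + e) * n * card (rednb Y x))"
    unfolding excess_def by (intro sum.cong refl) (simp add: sum_subtractf n_def algebra_simps)
  also have "\<dots> = (\<Sum>y\<in>Y. (d y)\<^sup>2) - (p + e) * n * D"
    by (simp add: sum_subtractf sq D flip: sum_distrib_left)
  also have "(p + e) * n = D / c" using De c0 by simp
  also have "(\<Sum>y\<in>Y. (d y)\<^sup>2) - D / c * D = ((\<Sum>y\<in>Y. (d y)\<^sup>2) * c - D\<^sup>2) / c"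
    using c0 by (simp add: field_simps power2_eq_square)
  also have "\<dots> \<ge> 0"
    using sum_squared_le_sum_of_squares[of d Y] c0 by (simp add: D_def c_def)
  finally show ?thesis .
qed

text \<open>The deviations \<open>h x\<close> sum to at least \<open>0\<close> and each is at most
  \<open>n * c\<close>, so excluding the few vertices of \<open>W\<close> still leaves one with
  \<open>h x\<close> not far below \<open>0\<close>. Splitting off its own contribution, at most
  \<open>z\<close>, leaves the two neighbourhoods. Both losses are measured against
  \<open>e * n * z\<close>, using \<open>p * c \<le> z\<close>.\<close>

lemma exists_good_vertex:
  fixes p e w :: real
  assumes fin: "finite X" "finite Y" and Y: "Y \<noteq> {}"
    and p: "0 < p" and e: "0 < e" "excess p X Y = e * card X * card Y"
    and deg: "\<And>x. x \<in> X \<Longrightarrow> p * card Y \<le> card (rednb Y x)"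
    and W: "W \<subseteq> X" "card W \<le> w" and w: "w < card X"
  shows "\<exists>x\<in>X - W. e * card X * card (rednb Y x) *
      (1 - (w / ((card X - w) * e * p) + 1 / (card X * e)))
      \<le> excess p (rednb X x) (rednb Y x) + excess p (bluenb X x) (rednb Y x)"
proof -
  define n where "n = real (card X)"
  define c where "c = real (card Y)"
  define h where "h x = excess p X (rednb Y x) - e * n * card (rednb Y x)" for x
  \<comment> \<open>Chosen so that \<open>(n - w) * \<omega> = w * (n * c)\<close>, the most that
    \<open>W\<close> can contribute to the sum.\<close>
  define \<omega> where "\<omega> = w * n * c / (n - w)"
  have n0: "0 < n" "w < n" "0 \<le> w" using w W(2) by (auto simp: n_def)
  have c0: "0 < c" using Y fin by (simp add: c_def card_gt_0_iff)
  have finW: "finite W" using W fin by (auto intro: finite_subset)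
  have hle: "h x \<le> n * c" for x
  proof -
    have "excess p X (rednb Y x) \<le> n * card (rednb Y x)"
      unfolding n_def using fin p by (intro excess_le) auto
    also have "\<dots> \<le> n * c"
      unfolding c_def using n0 fin nb_subset by (intro mult_left_mono) (auto simp: card_mono)
    moreover have "0 \<le> e * n * card (rednb Y x)" using e n0 by simp
    ultimately show ?thesis by (simp add: h_def)
  qed
  have "\<exists>x\<in>X - W. - \<omega> \<le> h x"
  proof (rule ccontr)
    assume "\<not> ?thesis"
    then have lt: "\<And>x. x \<in> X - W \<Longrightarrow> h x < - \<omega>" by (auto simp: not_le)
    have cd: "card (X - W) = card X - card W" "card W < card X"
      using W finW w by (auto simp: card_Diff_subset)
    then have ne: "X - W \<noteq> {}" using fin by (metis card.empty zero_less_diff less_irrefl)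
    have "0 \<le> (\<Sum>x\<in>X. h x)"
      unfolding h_def n_def by (rule sum_excess_rednb_ge) (use fin Y e in auto)
    also have "\<dots> = (\<Sum>x\<in>X - W. h x) + (\<Sum>x\<in>W. h x)"
      using W fin by (simp add: sum.subset_diff)
    also have "\<dots> < (\<Sum>x\<in>X - W. - \<omega>) + (\<Sum>x\<in>W. n * c)"
      using ne fin lt hle by (intro add_less_le_mono sum_strict_mono sum_mono) auto
    also have "\<dots> = - ((n - card W) * \<omega>) + card W * (n * c)"
      using cd by (simp add: n_def)
    also have "\<dots> \<le> - ((n - w) * \<omega>) + w * (n * c)"
    proof -
      have "0 \<le> \<omega>" using n0 c0 by (simp add: \<omega>_def)
      then have "(n - w) * \<omega> \<le> (n - card W) * \<omega>"
        using W by (intro mult_right_mono) auto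
      moreover have "card W * (n * c) \<le> w * (n * c)"
        using W n0 c0 by (intro mult_right_mono) auto
      ultimately show ?thesis by linarith
    qed
    also have "\<dots> = 0" using n0 by (simp add: \<omega>_def)
    finally show False by simp
  qed
  then obtain x where x: "x \<in> X" "x \<notin> W" "- \<omega> \<le> h x" by auto
  define z where "z = real (card (rednb Y x))"
  have pz: "p * c \<le> z" using deg[OF x(1)] by (simp add: z_def c_def)
  have z0: "0 < z" using pz p c0 by (meson less_le_trans mult_pos_pos)
  have "\<omega> \<le> e * n * z * (w / ((n - w) * e * p))"
  proof -
    have "\<omega> = (w * n / (n - w)) * c" by (simp add: \<omega>_def)
    also have "\<dots> \<le> (w * n / (n - w)) * (z / p)"
      using pz p n0 by (intro mult_left_mono) (auto simp: field_simps)
    also have "\<dots> = e * n * z * (w / ((n - w) * e * p))"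
      using e p n0 by (simp add: field_simps)
    finally show ?thesis .
  qed
  moreover have "z = e * n * z * (1 / (n * e))" using e n0 by simp
  moreover have "card (rednb (rednb Y x) x) - p * card (rednb Y x) \<le> z"
  proof -
    have "card (rednb (rednb Y x) x) \<le> card (rednb Y x)"
      using fin nb_subset by (simp add: card_mono)
    moreover have "0 \<le> p * card (rednb Y x)" using p by simp
    ultimately show ?thesis unfolding z_def by linarith
  qed
  moreover have "excess p X (rednb Y x) = card (rednb (rednb Y x) x) - p * card (rednb Y x) +
      excess p (rednb X x) (rednb Y x) + excess p (bluenb X x) (rednb Y x)"
    using fin x by (intro excess_nb) auto
  moreover have "e * n * z - \<omega> \<le> excess p X (rednb Y x)"
    using x by (simp add: h_def z_def)
  ultimately have "e * n * z - e * n * z * (w / ((n - w) * e * p)) - e * n * z * (1 / (n * e))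
     \<le> excess p (rednb X x) (rednb Y x) + excess p (bluenb X x) (rednb Y x)"
    by linarith
  then have "e * n * z * (1 - (w / ((n - w) * e * p) + 1 / (n * e)))
     \<le> excess p (rednb X x) (rednb Y x) + excess p (bluenb X x) (rednb Y x)"
    by (simp only: right_diff_distrib distrib_left mult_1_right)
  then show ?thesis
    using x unfolding n_def z_def by blast
qed

end

subsection \<open>The potential argument\<close>

text \<open>Bounds, independently of \<open>g\<close>, the loss in the potential when the relative
  excess drops by a factor \<open>1 - 1 / g\<close>. The reciprocal is at most
  \<open>exp (g / (g - 1)) \<le> exp 2\<close>.\<close>

lemma one_minus_inverse_power_ge:
  assumes "2 \<le> g"
  shows "1 / 9 \<le> (1 - 1 / real g) ^ g"
proof -
  define h where "h = real g - 1"
  have h: "1 \<le> h" "real g = h + 1" using assms by (auto simp: h_def)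
  have eq: "1 - 1 / real g = 1 / (1 + 1 / h)"
    using h by (simp add: field_simps)
  have "(1 + 1 / h) ^ g \<le> exp (1 / h) ^ g"
    using h exp_ge_add_one_self[of "1 / h"] by (intro power_mono) (auto simp: add.commute)
  also have "\<dots> = exp (real g / h)"
    by (simp flip: exp_of_nat_mult)
  also have "\<dots> \<le> exp (1 + 1)"
    using h by (simp add: field_simps)
  also have "\<dots> \<le> 3 * 3"
    unfolding exp_add using exp_le by (intro mult_mono) auto
  finally have "(1 + 1 / h) ^ g \<le> 9" by simp
  moreover have "0 < (1 + 1 / h) ^ g" using h by (simp add: add_pos_pos)
  ultimately show ?thesis
    unfolding eq by (simp add: power_one_over power_divide frac_le)
qed

context red_graph
begin

text \<open>The red density minus \<open>p\<close>. It is \<open>0\<close> if a set is empty, so a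
  positive value certifies that both sets are nonempty.\<close>

definition rel_excess :: "real \<Rightarrow> 'a set \<Rightarrow> 'a set \<Rightarrow> real" where
  "rel_excess p A B = excess p A B / (real (card A) * real (card B))"

lemma excess_eq_rel_excess:
  assumes "finite A" "finite B" "A \<noteq> {}" "B \<noteq> {}"
  shows "excess p A B = rel_excess p A B * card A * card B"
  using assms by (simp add: rel_excess_def)

lemma rel_excess_le_1:
  assumes "finite B" "0 \<le> p"
  shows "rel_excess p A B \<le> 1"
  unfolding rel_excess_def using excess_le[OF assms, of A] by (intro divide_le_eq_1[THEN iffD2]) (auto simp: order_le_less)

lemma rel_excess_geI:
  fixes d p :: real
  assumes "finite A" "finite B" "A \<noteq> {}" "B \<noteq> {}"
    and "\<And>x. x \<in> A \<Longrightarrow> d * card B \<le> card (rednb B x) - p * card B"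
  shows "d \<le> rel_excess p A B"
proof -
  have "(\<Sum>x\<in>A. d * card B) \<le> excess p A B"
    unfolding excess_def using assms(5) by (intro sum_mono) auto
  then show ?thesis
    using assms by (simp add: rel_excess_def pos_le_divide_eq card_gt_0_iff mult_ac)
qed

text \<open>Deleting a vertex with less than \<open>(1 - 1 / g)\<close> times the average excess
  raises the average by a factor of at least \<open>1 + 1 / (g * n)\<close>, where \<open>n\<close>
  is the remaining size. Its \<open>g\<close>-th power makes up for the lost vertex, so the
  potential does not drop.\<close>

lemma remove_low_degree:
  fixes p e :: real
  assumes fin: "finite X" "finite Y" and Y: "Y \<noteq> {}" and g: "0 < g"
    and e: "0 < e" "e = rel_excess p X Y" and x: "x \<in> X"
    and low: "card (rednb Y x) - p * card Y < (1 - 1 / g) * e * card Y"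
  shows "0 < rel_excess p (X - {x}) Y"
    and "card X * e ^ g \<le> card (X - {x}) * rel_excess p (X - {x}) Y ^ g"
proof -
  define c where "c = real (card Y)"
  define n where "n = real (card (X - {x}))"
  have c0: "0 < c" using Y fin by (simp add: c_def card_gt_0_iff)
  have nX: "real (card X) = n + 1"
    using card.remove[OF fin(1) x] by (simp add: n_def)
  have "excess p X Y = e * card X * card Y"
    unfolding e(2) using x fin Y by (intro excess_eq_rel_excess) auto
  moreover have "excess p X Y = card (rednb Y x) - p * c + excess p (X - {x}) Y"
    unfolding excess_def c_def using fin x by (simp add: sum.remove)
  ultimately have ex: "e * (n + 1 / g) * c < excess p (X - {x}) Y"
    using low by (simp add: nX c_def algebra_simps)
  have "0 < e * (n + 1 / g) * c"
    using e c0 g by (intro mult_pos_pos add_nonneg_pos) (auto simp: n_def)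
  then have "0 < excess p (X - {x}) Y" using ex by linarith
  then have "X - {x} \<noteq> {}" unfolding excess_def by (metis less_irrefl sum.empty)
  then have n0: "1 \<le> n" using fin by (simp add: n_def Suc_le_eq card_gt_0_iff)
  define e' where "e' = rel_excess p (X - {x}) Y"
  have "excess p (X - {x}) Y = e' * n * c"
    using n0 c0 by (simp add: e'_def rel_excess_def n_def c_def)
  then have "e * (n + 1 / g) * c < e' * n * c" using ex by simp
  then have "e * (n + 1 / g) < e' * n" using c0 by simp
  then have e': "e * (1 + 1 / (g * n)) \<le> e'"
    using n0 g by (simp add: field_simps)
  moreover have "0 < e * (1 + 1 / (g * n))"
    using e n0 g by (intro mult_pos_pos add_pos_nonneg) auto
  ultimately show "0 < rel_excess p (X - {x}) Y" by (simp add: e'_def)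
  \<comment> \<open>The size ratio \<open>1 + 1 / n\<close> is written as
    \<open>1 + g * (1 / (g * n))\<close> to fit Bernoulli's inequality.\<close>
  have "(n + 1) * e ^ g = n * (e ^ g * (1 + real g * (1 / (g * n))))"
    using n0 g by (simp add: field_simps)
  also have "\<dots> \<le> n * (e ^ g * (1 + 1 / (g * n)) ^ g)"
  proof (intro mult_left_mono)
    have "0 \<le> 1 / (real g * n)" using n0 by simp
    then show "1 + real g * (1 / (g * n)) \<le> (1 + 1 / (g * n)) ^ g"
      by (intro Bernoulli_inequality) linarith
  qed (use e n0 in auto)
  also have "\<dots> = n * (e * (1 + 1 / (g * n))) ^ g"
    by (simp add: power_mult_distrib)
  also have "\<dots> \<le> n * e' ^ g"
    using e' n0 e by (intro mult_left_mono power_mono) (auto intro!: mult_nonneg_nonneg add_nonneg_nonneg)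
  finally show "card X * e ^ g \<le> card (X - {x}) * rel_excess p (X - {x}) Y ^ g"
    by (simp add: nX n_def e'_def)
qed

text \<open>Invariant: the potential pays \<open>exp \<alpha>\<close> for each missing red vertex
  and \<open>exp \<beta>\<close> for each missing blue vertex in \<open>X\<close>. The set
  \<open>Y\<close> shrinks only to red neighbourhoods, so red vertices found in \<open>X\<close>
  extend red cliques of both sets, while the blue target \<open>L\<close> for \<open>Y\<close> stays
  fixed. \<open>Z\<close> is the size of \<open>X\<close> below which \<open>Y\<close> alone is
  used, and \<open>U\<close> bounds the product of the sizes, so that a large potential forces a
  lower bound on the excess. The induction is on \<open>card X\<close>.\<close>

lemma book_induction:
  fixes p \<mu> \<eta> \<kappa> \<alpha> \<beta> \<zeta> U Q Z :: real and g m b K L w :: nat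
  assumes p: "0 < p" "p < 1" and \<mu>: "0 < \<mu>" "\<mu> < 1" and \<eta>: "0 < \<eta>" and g: "2 \<le> g"
    and \<kappa>: "\<kappa> = - ln p / (1 - \<mu>)"
    and small: "2 * \<eta> \<le> g" "4 * \<kappa>\<^sup>2 \<le> \<eta> * g" "\<kappa> \<le> g" "\<zeta> < \<eta> / (2 * g)"
    and \<alpha>: "0 \<le> \<alpha>" "exp (- \<alpha>) \<le> (1 - \<mu>) * p powr (1 / (1 - \<mu>)) * exp (- \<eta>)"
    and \<beta>: "0 \<le> \<beta>" "exp (- \<beta>) \<le> \<mu> * exp (- \<eta>)"
    and b: "1 \<le> b" "2 * real b ^ 2 \<le> \<mu> ^ b * m" "18 \<le> exp (\<eta> * b)"
    and Q: "1 \<le> Q" and Z: "0 < Z"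
    and ramsey_book: "\<And>A. finite A \<Longrightarrow> w \<le> card A \<Longrightarrow> has_red K A \<or> has_blue m A"
    and ramsey_end: "\<And>k A. finite A \<Longrightarrow> k \<le> K \<Longrightarrow> Q * exp (\<alpha> * k) / Z \<le> card A \<Longrightarrow>
      has_red k A \<or> has_blue L A"
    and size: "\<And>(n::real) (e::real). Z \<le> n \<Longrightarrow> 0 < e \<Longrightarrow> 1 \<le> U * e ^ g \<Longrightarrow>
      w < n \<and> w / ((n - w) * e * p) + 1 / (n * e) \<le> \<zeta>"
  shows "finite X \<Longrightarrow> finite Y \<Longrightarrow> k \<le> K \<Longrightarrow> real (card X) * card Y \<le> U \<Longrightarrow>
    0 < rel_excess p X Y \<Longrightarrow>
    Q * exp (\<alpha> * k + \<beta> * l) \<le> real (card X) * card Y * rel_excess p X Y ^ g \<Longrightarrow>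
    has_red k (X \<union> Y) \<or> has_blue l X \<or> has_blue L Y"
proof (induction "card X" arbitrary: X Y k l rule: less_induct)
  case less
  note fin = less.prems(1,2)
  define n where "n = real (card X)"
  define c where "c = real (card Y)"
  define e where "e = rel_excess p X Y"
  have e0: "0 < e" using less.prems by (simp add: e_def)
  then have ne: "X \<noteq> {}" "Y \<noteq> {}" by (auto simp: e_def rel_excess_def excess_def)
  have n0: "0 < n" using ne fin by (simp add: n_def card_gt_0_iff)
  have c0: "0 < c" using ne fin by (simp add: c_def card_gt_0_iff)
  have e1: "e \<le> 1" unfolding e_def using fin p by (intro rel_excess_le_1) auto
  have exc: "excess p X Y = e * n * c"
    unfolding e_def n_def c_def using fin ne by (intro excess_eq_rel_excess) auto
  have pot: "Q * exp (\<alpha> * k + \<beta> * l) \<le> n * c * e ^ g"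
    using less.prems by (simp add: n_def c_def e_def)
  have ncU: "n * c \<le> U" using less.prems by (simp add: n_def c_def)
  have IH: "has_red k' (X' \<union> Y') \<or> has_blue l' X' \<or> has_blue L Y'"
    if "X' \<subseteq> X" "x \<in> X" "x \<notin> X'" "Y' \<subseteq> Y" "k' \<le> k" "0 < rel_excess p X' Y'"
      "Q * exp (\<alpha> * k' + \<beta> * l') \<le> real (card X') * card Y' * rel_excess p X' Y' ^ g"
    for X' Y' k' l' x
  proof (rule less.hyps)
    show "card X' < card X" using that fin by (intro psubset_card_mono) auto
    show "finite X'" "finite Y'" using that fin by (auto intro: finite_subset)
    show "k' \<le> K" using that less.prems by simp
    have "card X' \<le> card X" "card Y' \<le> card Y" using that fin by (auto intro: card_mono)
    then have "real (card X') * card Y' \<le> n * c"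
      unfolding n_def c_def by (intro mult_mono) auto
    then show "real (card X') * card Y' \<le> U" using ncU by linarith
  qed (use that in auto)
  show ?case
  proof (cases "k = 0 \<or> l = 0")
    case True
    then show ?thesis by auto
  next
    case False
    then have kl: "1 \<le> k" "1 \<le> l" by auto
    show ?thesis
    proof (cases "n < Z")
      case True
      \<comment> \<open>With \<open>X\<close> smaller than \<open>Z\<close> and
        \<open>e \<le> 1\<close>, the potential can only be large because \<open>Y\<close> is;
        \<open>ramsey_end\<close> then applies to \<open>Y\<close>.\<close>
      have "Q * exp (\<alpha> * k) \<le> Q * exp (\<alpha> * k + \<beta> * l)"
        using Q \<beta> by (intro mult_left_mono) auto
      also have "\<dots> \<le> n * c * e ^ g" by (rule pot)
      also have "\<dots> \<le> n * c * 1"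
        using n0 c0 e0 e1 by (intro mult_left_mono) (auto simp: power_le_one)
      also have "\<dots> \<le> Z * c" using True c0 by simp
      finally have "Q * exp (\<alpha> * k) / Z \<le> card Y"
        using Z by (simp add: c_def field_simps)
      then have "has_red k Y \<or> has_blue L Y"
        using ramsey_end[OF fin(2)] less.prems by blast
      then show ?thesis
        using has_clique_mono[of red k Y "X \<union> Y"] by blast
    next
      case False
      then have nZ: "Z \<le> n" by simp
      have "1 * 1 \<le> Q * exp (\<alpha> * k + \<beta> * l)"
        using Q \<alpha> \<beta> by (intro mult_mono) auto
      also have "\<dots> \<le> U * e ^ g"
      proof -
        have "n * c * e ^ g \<le> U * e ^ g" using ncU e0 by (intro mult_right_mono) auto
        then show ?thesis using pot by linarith
      qed
      finally have "1 \<le> U * e ^ g" by simp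
      note sz = size[OF nZ e0 this]
      show ?thesis
      \<comment> \<open>Vertices of low degree are discarded first. Afterwards every vertex has
        excess at least \<open>(1 - 1 / g) * e\<close>, hence degree at least
        \<open>p * card Y\<close>, and every nonempty subset of \<open>X\<close> retains this
        relative excess.\<close>
      proof (cases "\<exists>x\<in>X. card (rednb Y x) - p * card Y < (1 - 1 / g) * e * card Y")
        case True
        then obtain x where x: "x \<in> X" "card (rednb Y x) - p * card Y < (1 - 1 / g) * e * card Y"
          by blast
        note rm = remove_low_degree[OF fin ne(2) _ e0 e_def x]
        have "c * (n * e ^ g) \<le> c * (card (X - {x}) * rel_excess p (X - {x}) Y ^ g)"
          using rm(2) g c0 by (intro mult_left_mono) (auto simp: n_def)
        then have "Q * exp (\<alpha> * k + \<beta> * l) \<le>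
            real (card (X - {x})) * card Y * rel_excess p (X - {x}) Y ^ g"
          using pot by (simp add: c_def mult_ac)
        then have "has_red k ((X - {x}) \<union> Y) \<or> has_blue l (X - {x}) \<or> has_blue L Y"
          using rm(1) g x by (intro IH[of _ x]) auto
        then show ?thesis
          using has_clique_mono[of red k "(X - {x}) \<union> Y" "X \<union> Y"]
            has_clique_mono[of "\<lambda>u v. \<not> red u v" l "X - {x}" X] by blast
      next
        case False
        then have deg: "(1 - 1 / g) * e * card Y \<le> card (rednb Y x) - p * card Y" if "x \<in> X" for x
          using that by (auto simp: not_less)
        have g1: "0 < 1 - 1 / real g" using g by simp
        \<comment> \<open>Vertices whose blue degree is too large for \<open>step_dichotomy\<close>.
          If there are many, a blue book is found inside them; if few, a good vertex exists
          outside.\<close>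
        define W where "W = {x\<in>X. \<mu> * n < card (bluenb X x)}"
        show ?thesis
        proof (cases "w \<le> card W")
          case True
          have finW: "finite W" using fin by (simp add: W_def)
          from ramsey_book[OF finW True] show ?thesis
          proof
            assume "has_red K W"
            then have "has_red k W" using less.prems(3) by (rule has_clique_decreasing)
            then show ?thesis
              using has_clique_mono[of red k W "X \<union> Y"] by (auto simp: W_def)
          next
            assume "has_blue m W"
            then obtain T where T: "T \<in> nsets W m" "\<forall>u\<in>T. \<forall>v\<in>T. u \<noteq> v \<longrightarrow> \<not> red u v"
              unfolding has_clique_def by blast
            then have T': "T \<subseteq> W" "finite T" "card T = m" by (auto simp: nsets_def)
            have "\<exists>S\<in>nsets T b. \<mu> ^ b / 2 * card X \<le> card {v\<in>X. \<forall>u\<in>S. v \<in> bluenb X u}"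
            proof (rule common_intersection)
              show "\<mu> * card X \<le> card (bluenb X u)" if "u \<in> T" for u
                using that T'(1) by (auto simp: W_def n_def)
              show "2 * real b ^ 2 \<le> \<mu> ^ b * card T" using b(2) T'(3) by simp
            qed (use T'(2) fin(1) nb_subset(2) \<mu> b(1) in simp_all)
            then obtain S where S: "S \<in> nsets T b"
              and Scard: "\<mu> ^ b / 2 * card X \<le> card {v\<in>X. \<forall>u\<in>S. v \<in> bluenb X u}" by blast
            define X' where "X' = {v\<in>X. \<forall>u\<in>S. v \<in> bluenb X u}"
            have ST: "S \<subseteq> T" "finite S" "card S = b" using S by (auto simp: nsets_def)
            then have SX: "S \<in> nsets X b" using T' by (auto simp: nsets_def W_def)
            have Sblue: "\<forall>u\<in>S. \<forall>v\<in>S. u \<noteq> v \<longrightarrow> \<not> red u v" using T(2) ST(1) by blast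
            show ?thesis
            proof (cases "l \<le> b")
              case True
              have "has_blue b X" using SX Sblue unfolding has_clique_def by blast
              then show ?thesis using True has_clique_decreasing by blast
            next
              case False
              have X'n: "\<mu> ^ b / 2 * n \<le> card X'" using Scard by (simp add: X'_def n_def)
              moreover have "0 < \<mu> ^ b / 2 * n" using \<mu> n0 by simp
              ultimately have "0 < real (card X')" by linarith
              then have X'ne: "X' \<noteq> {}" "finite X'" by (auto simp: card_gt_0_iff)
              define e' where "e' = rel_excess p X' Y"
              have e': "(1 - 1 / g) * e \<le> e'"
                unfolding e'_def using X'ne fin ne deg
                by (intro rel_excess_geI) (auto simp: X'_def)
              have e'0: "0 < (1 - 1 / g) * e" using g1 e0 by simp
              from S b(1) obtain x where x: "x \<in> S" using ST by (metis card.empty ex_in_conv not_one_le_zero)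
              then have xX: "x \<in> X" "x \<notin> X'" using SX by (auto simp: nsets_def X'_def bluenb_def)
              \<comment> \<open>Budget of the book step: \<open>b\<close> blue vertices release
                \<open>exp (- (\<beta> * b))\<close>. The slack \<open>exp (- \<eta>)\<close> per
                vertex must absorb the factor \<open>1/2\<close> of
                \<open>common_intersection\<close> and the factor \<open>1/9\<close> from the drop
                in excess; hence \<open>18\<close>.\<close>
              have "exp (- (\<beta> * b)) = exp (- \<beta>) ^ b"
                by (simp flip: exp_of_nat_mult add: mult_ac)
              also have "\<dots> \<le> (\<mu> * exp (- \<eta>)) ^ b" using \<beta> by (intro power_mono) auto
              also have "\<dots> = \<mu> ^ b * (1 / exp (\<eta> * b))"
                by (simp add: power_divide exp_minus divide_inverse power_mult_distrib mult.commute[of \<eta>]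
                    exp_of_nat_mult power_inverse)
              also have "\<dots> \<le> \<mu> ^ b * (1 / 18)"
                using b(3) \<mu> by (intro mult_left_mono divide_left_mono) auto
              finally have "exp (- (\<beta> * b)) \<le> \<mu> ^ b / 18" by simp
              then have "n * c * e ^ g * exp (- (\<beta> * b)) \<le> n * c * e ^ g * (\<mu> ^ b / 18)"
                using n0 c0 e0 by (intro mult_left_mono) auto
              also have "\<dots> = (\<mu> ^ b / 2 * n) * c * (1 / 9 * e ^ g)" by simp
              also have "\<dots> \<le> card X' * c * ((1 - 1 / g) ^ g * e ^ g)"
                using X'n c0 e0 one_minus_inverse_power_ge[OF g] \<mu> n0
                by (intro mult_mono mult_right_mono) auto
              also have "\<dots> = card X' * c * ((1 - 1 / g) * e) ^ g"
                by (simp add: power_mult_distrib)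
              also have "\<dots> \<le> card X' * c * e' ^ g"
                using e' e'0 c0 by (intro mult_left_mono power_mono) auto
              finally have "n * c * e ^ g * exp (- (\<beta> * b)) \<le> card X' * c * e' ^ g" .
              moreover have "Q * exp (\<alpha> * k + \<beta> * l) * exp (- (\<beta> * b)) \<le> n * c * e ^ g * exp (- (\<beta> * b))"
                using pot by (intro mult_right_mono) auto
              moreover have "Q * exp (\<alpha> * k + \<beta> * l) * exp (- (\<beta> * b)) = Q * exp (\<alpha> * k + \<beta> * (l - b))"
                using False by (simp add: algebra_simps of_nat_diff flip: exp_add)
              ultimately have "Q * exp (\<alpha> * k + \<beta> * (l - b)) \<le> real (card X') * card Y * e' ^ g"
                by (simp add: c_def)
              moreover have "0 < e'" using e' e'0 by linarith
              ultimately have "has_red k (X' \<union> Y) \<or> has_blue (l - b) X' \<or> has_blue L Y"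
                using xX by (intro IH[of _ x]) (auto simp: X'_def e'_def)
              moreover have "has_blue l X" if "has_blue (l - b) X'"
              proof -
                \<comment> \<open>The clique \<open>S\<close> is blue to all of \<open>X'\<close>,
                  so it completes any blue clique found there.\<close>
                have "has_blue ((l - b) + b) (X' \<union> X)"
                  using that SX Sblue
                  by (rule has_clique_Un) (auto simp: X'_def bluenb_def intro: red_sym)
                then show ?thesis using False by (simp add: X'_def Un_absorb1)
              qed
              moreover have "has_red k (X \<union> Y)" if "has_red k (X' \<union> Y)"
                using that by (rule has_clique_mono) (auto simp: X'_def)
              ultimately show ?thesis by blast
            qed
          qed
        next
          case False
          have pdeg: "p * card Y \<le> card (rednb Y x)" if "x \<in> X" for x
          proof -
            have "0 \<le> (1 - 1 / g) * e * card Y" using g1 e0 by simp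
            then show ?thesis using deg[OF that] by linarith
          qed
          have "\<exists>x\<in>X - W. e * card X * card (rednb Y x) *
              (1 - (w / ((real (card X) - real w) * e * p) + 1 / (card X * e)))
              \<le> excess p (rednb X x) (rednb Y x) + excess p (bluenb X x) (rednb Y x)"
            by (rule exists_good_vertex)
              (use fin ne p e0 exc pdeg False sz in \<open>auto simp: W_def n_def c_def\<close>)
          then obtain x where x: "x \<in> X" "x \<notin> W"
            and xe: "e * n * card (rednb Y x) * (1 - (w / ((n - w) * e * p) + 1 / (n * e)))
              \<le> excess p (rednb X x) (rednb Y x) + excess p (bluenb X x) (rednb Y x)"
            unfolding n_def by blast
          define z where "z = real (card (rednb Y x))"
          define R where "R = rednb X x"
          define B where "B = bluenb X x"
          define eR where "eR = rel_excess p R (rednb Y x)"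
          define eB where "eB = rel_excess p B (rednb Y x)"
          have pz: "p * c \<le> z" using pdeg[OF x(1)] by (simp add: z_def c_def)
          have z0: "0 < z" using pz p c0 by (meson less_le_trans mult_pos_pos)
          have exR: "excess p R (rednb Y x) = card R * z * eR" and exB: "excess p B (rednb Y x) = card B * z * eB"
            using fin z0 unfolding eR_def eB_def rel_excess_def z_def R_def B_def
            by (auto simp: excess_def card_eq_0_iff)
          \<comment> \<open>Normalising by \<open>e * n * z\<close> turns the inequality at the good
            vertex into the hypothesis \<open>avg\<close> of the dichotomy.\<close>
          have "e * n * z * (1 - \<zeta>) \<le> e * n * z * (1 - (w / ((n - w) * e * p) + 1 / (n * e)))"
            using sz e0 n0 z0 by (intro mult_left_mono) auto
          also have "\<dots> \<le> card R * z * eR + card B * z * eB"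
            using xe exR exB unfolding z_def[symmetric] R_def[symmetric] B_def[symmetric] by linarith
          also have "\<dots> = e * n * z * (card R / n * (eR / e) + card B / n * (eB / e))"
            using e0 n0 by (simp add: field_simps)
          finally have avg: "1 - \<zeta> \<le> card R / n * (eR / e) + card B / n * (eB / e)"
            using e0 n0 z0 by simp
          have RB: "real (card R) + card B \<le> n"
            using card_nb[OF fin(1) x(1)] by (simp add: n_def R_def B_def)
          have "card B \<le> \<mu> * n" using x by (auto simp: W_def B_def)
          then have
            "(0 < card R / n \<and> 0 < eR / e \<and>
              card R / n * p * (eR / e) ^ g \<ge> (1 - \<mu>) * p powr (1 / (1 - \<mu>)) * exp (- \<eta>)) \<or>
             (0 < card B / n \<and> 0 < eB / e \<and> card B / n * p * (eB / e) ^ g \<ge> \<mu> * exp (- \<eta>))"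
            using RB n0 g
            by (intro step_dichotomy[OF p \<mu> \<eta> _ \<kappa> small _ _ _ _ avg]) (auto simp: field_simps)
          then consider
            (red) "0 < eR / e" "exp (- \<alpha>) \<le> card R / n * p * (eR / e) ^ g"
            | (blue) "0 < eB / e" "exp (- \<beta>) \<le> card B / n * p * (eB / e) ^ g"
            using \<alpha>(2) \<beta>(2) by fastforce
          then show ?thesis
          proof cases
            case red
            have eR0: "0 < eR" using red e0 by (simp add: zero_less_divide_iff)
            \<comment> \<open>The potential of \<open>R\<close> and \<open>rednb Y x\<close> is the
              old one times the factor from the dichotomy, with \<open>p\<close> covering the
              shrinkage of \<open>Y\<close> since \<open>p * c \<le> z\<close>. The blue case is
              analogous.\<close>
            have "Q * exp (\<alpha> * k + \<beta> * l) * exp (- \<alpha>) \<le> n * c * e ^ g * (card R / n * p * (eR / e) ^ g)"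
              by (rule mult_mono[OF pot red(2)]) (use n0 c0 e0 in auto)
            also have "\<dots> = card R * (p * c) * eR ^ g"
              using n0 e0 by (simp add: power_divide)
            also have "\<dots> \<le> card R * z * eR ^ g"
              using pz eR0 by (intro mult_right_mono mult_left_mono) auto
            finally have "Q * exp (\<alpha> * (k - 1) + \<beta> * l) \<le> real (card R) * card (rednb Y x) * eR ^ g"
              using kl by (simp add: z_def algebra_simps of_nat_diff flip: exp_add)
            then have "has_red (k - 1) (R \<union> rednb Y x) \<or> has_blue l R \<or> has_blue L (rednb Y x)"
              using eR0 x nb_subset by (intro IH[of _ x]) (auto simp: eR_def R_def rednb_def)
            moreover have "has_red k (X \<union> Y)" if "has_red (k - 1) (R \<union> rednb Y x)"
            proof -
              have "R \<union> rednb Y x = rednb (X \<union> Y) x" by (auto simp: R_def rednb_def)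
              then show ?thesis
                using has_red_extend[of "k - 1" "X \<union> Y" x] that x kl by simp
            qed
            moreover have "has_blue l X" if "has_blue l R"
              using that by (rule has_clique_mono) (auto simp: R_def rednb_def)
            moreover have "has_blue L Y" if "has_blue L (rednb Y x)"
              using that by (rule has_clique_mono) (auto simp: rednb_def)
            ultimately show ?thesis by blast
          next
            case blue
            have eB0: "0 < eB" using blue e0 by (simp add: zero_less_divide_iff)
            have "Q * exp (\<alpha> * k + \<beta> * l) * exp (- \<beta>) \<le> n * c * e ^ g * (card B / n * p * (eB / e) ^ g)"
              by (rule mult_mono[OF pot blue(2)]) (use n0 c0 e0 in auto)
            also have "\<dots> = card B * (p * c) * eB ^ g"
              using n0 e0 by (simp add: power_divide)
            also have "\<dots> \<le> card B * z * eB ^ g"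
              using pz eB0 by (intro mult_right_mono mult_left_mono) auto
            finally have "Q * exp (\<alpha> * k + \<beta> * (l - 1)) \<le> real (card B) * card (rednb Y x) * eB ^ g"
              using kl by (simp add: z_def algebra_simps of_nat_diff flip: exp_add)
            then have "has_red k (B \<union> rednb Y x) \<or> has_blue (l - 1) B \<or> has_blue L (rednb Y x)"
              using eB0 x nb_subset by (intro IH[of _ x]) (auto simp: eB_def B_def bluenb_def rednb_def)
            moreover have "has_red k (X \<union> Y)" if "has_red k (B \<union> rednb Y x)"
              using that by (rule has_clique_mono) (auto simp: B_def bluenb_def rednb_def)
            moreover have "has_blue l X" if "has_blue (l - 1) B"
              using has_blue_extend[of "l - 1" X x] that x kl by (simp add: B_def)
            moreover have "has_blue L Y" if "has_blue L (rednb Y x)"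
              using that by (rule has_clique_mono) (auto simp: rednb_def)
            ultimately show ?thesis by blast
          qed
        qed
      qed
    qed
  qed
qed

end

subsection \<open>Dense colourings\<close>

text \<open>The sum in the expansion of \<open>(t + 1) ^ (a + b)\<close> dominates its term of index
  \<open>b\<close>. For small \<open>t\<close> the bound is subexponential both for fixed
  \<open>b\<close> and for \<open>b\<close> a tiny fraction of \<open>a\<close>.\<close>

lemma binomial_le_exp:
  fixes t :: real
  assumes "0 < t"
  shows "real ((a + b) choose b) \<le> exp (t * real (a + b)) / t ^ b"
proof -
  have "real ((a + b) choose b) * t ^ b = real ((a + b) choose b) * t ^ b * 1 ^ (a + b - b)"
    by simp
  also have "\<dots> \<le> (\<Sum>i\<le>a + b. real ((a + b) choose i) * t ^ i * 1 ^ (a + b - i))"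
    using assms by (intro member_le_sum) auto
  also have "\<dots> = (t + 1) ^ (a + b)"
    by (rule binomial_ring[symmetric])
  also have "\<dots> \<le> exp t ^ (a + b)"
    using assms exp_ge_add_one_self[of t] by (intro power_mono) (auto simp: add.commute)
  also have "\<dots> = exp (t * real (a + b))"
    by (simp only: mult.commute[of t] exp_of_nat_mult)
  finally show ?thesis
    using assms by (simp add: pos_le_divide_eq)
qed

lemma exp_eventually_ge:
  fixes s M :: real
  assumes "0 < s"
  shows "\<exists>K0::nat. \<forall>K\<ge>K0. M \<le> exp (s * real K)"
proof -
  have "M \<le> exp (s * real K)" if "nat \<lceil>M / s\<rceil> \<le> K" for K
  proof -
    have "M / s \<le> real K" using that by linarith
    then have "M \<le> s * real K" using assms by (simp add: field_simps)
    then show ?thesis using exp_ge_add_one_self[of "s * real K"] by linarith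
  qed
  then show ?thesis by blast
qed

lemma ramsey_number_le_two_power: "real (ramsey_number k l) \<le> 2 ^ (k + l)"
proof -
  have "ramsey_number k l \<le> 2 ^ (k + l)"
    using ramsey_number_le_binomial[of k l] binomial_le_pow2[of "k + l" l] by linarith
  then show ?thesis by (metis of_nat_le_iff of_nat_numeral of_nat_power)
qed

lemma powi_minus_eq_exp:
  fixes x :: real
  assumes "0 < x"
  shows "x powi (- int k) = exp (- (real k * ln x))"
  using assms by (simp add: power_int_minus exp_minus exp_of_nat_mult)

text \<open>Applies \<open>book_induction\<close> with \<open>V\<close> in both roles, so the
  potential is at least \<open>card V\<close> squared times \<open>\<delta> ^ g\<close>; this is why
  \<open>2 * ln (card V)\<close> appears. The summand \<open>2 * \<eta> * K\<close> pays once for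
  the threshold \<open>Z\<close> and once for the constants.\<close>

lemma dense_graph_ramsey:
  fixes p \<mu> \<eta> \<alpha> \<beta> \<delta> x y :: real
  assumes p: "0 < p" "p < 1" and \<mu>: "0 < \<mu>" "\<mu> < 1" and \<eta>: "0 < \<eta>" and \<delta>: "0 < \<delta>"
    and xy: "0 < x" "0 < y" "y < 1"
    and region: "\<And>k l. 1 \<le> k \<Longrightarrow> 1 \<le> l \<Longrightarrow> N0 \<le> k + l \<Longrightarrow>
      real (ramsey_number k l) \<le> x powi (- int k) * y powi (- int l)"
    and \<alpha>: "- ln x \<le> \<alpha>" "exp (- \<alpha>) \<le> (1 - \<mu>) * p powr (1 / (1 - \<mu>)) * exp (- \<eta>)"
    and \<beta>: "\<beta> = - ln \<mu> + \<eta>"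
  shows "\<exists>K0::nat. \<forall>K\<ge>K0. \<forall>l (red :: 'a \<Rightarrow> 'a \<Rightarrow> bool) V.
    1 \<le> l \<longrightarrow> l \<le> K \<longrightarrow> red_graph red \<longrightarrow> finite V \<longrightarrow>
    (\<forall>v\<in>V. (p + \<delta>) * card V \<le> card (red_graph.rednb red V v)) \<longrightarrow>
    \<alpha> * K + \<beta> * l - l * ln y + 2 * \<eta> * K \<le> 2 * ln (card V) \<longrightarrow>
    has_clique red K V \<or> has_clique (\<lambda>u v. \<not> red u v) l V"
proof -
  define \<kappa> where "\<kappa> = - ln p / (1 - \<mu>)"
  \<comment> \<open>The last bound on \<open>g\<close> ensures that
    \<open>1 \<le> 16 ^ K * e ^ g\<close> forces \<open>e \<ge> exp (- (\<eta> / 2 * K))\<close>;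
    the others are those of \<open>step_dichotomy\<close>.\<close>
  obtain g :: nat where "max (max 2 (2 * \<eta>)) (max (max (4 * \<kappa>\<^sup>2 / \<eta>) \<kappa>) (2 * ln 16 / \<eta>)) \<le> g"
    using real_arch_simple by blast
  then have g: "2 \<le> g" "2 * \<eta> \<le> g" "4 * \<kappa>\<^sup>2 \<le> \<eta> * g" "\<kappa> \<le> g" "2 * ln 16 \<le> \<eta> * g"
    using \<eta> by (auto simp: pos_divide_le_eq mult.commute)
  define \<zeta> where "\<zeta> = \<eta> / (4 * g)"
  have \<zeta>: "0 < \<zeta>" "\<zeta> < \<eta> / (2 * g)" "\<zeta> \<le> 1 / 8"
    using \<eta> g by (auto simp: \<zeta>_def divide_simps)
  obtain b :: nat where b18: "18 / \<eta> \<le> b"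
    using real_arch_simple by blast
  have b1: "1 \<le> b"
  proof (rule ccontr)
    assume "\<not> 1 \<le> b"
    then have "b = 0" by simp
    moreover have "0 < 18 / \<eta>" using \<eta> by simp
    ultimately show False using b18 by simp
  qed
  have b2: "18 \<le> exp (\<eta> * b)"
  proof -
    have "18 \<le> \<eta> * b" using b18 \<eta> by (simp add: pos_divide_le_eq mult.commute)
    then show ?thesis using exp_ge_add_one_self[of "\<eta> * b"] by linarith
  qed
  obtain m :: nat where "2 * real b ^ 2 / \<mu> ^ b \<le> m"
    using real_arch_simple by blast
  then have m: "2 * real b ^ 2 \<le> \<mu> ^ b * m"
    using \<mu> by (simp add: pos_divide_le_eq mult.commute)
  \<comment> \<open>Covers the finitely many pairs with \<open>k + l < N0\<close>, where the region
    gives no bound.\<close>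
  define C0 :: real where "C0 = 2 ^ N0"
  have C0: "1 \<le> C0" by (simp add: C0_def)
  \<comment> \<open>From \<open>binomial_le_exp\<close> with \<open>t = \<eta> / 4\<close>: as
    \<open>m\<close> is fixed, the Erdos-Szekeres number \<open>w\<close> is at most
    \<open>C1 * exp (\<eta> / 4 * K)\<close>.\<close>
  define C1 where "C1 = exp (\<eta> / 4 * m) / (\<eta> / 4) ^ m"
  have C1: "0 < C1" using \<eta> by (simp add: C1_def)
  obtain K1 :: nat where K1: "\<And>K. K1 \<le> K \<Longrightarrow> (2 * C1 / p + 1) / \<zeta> \<le> exp (\<eta> / 4 * real K)"
    using exp_eventually_ge[of "\<eta> / 4"] \<eta> by (meson divide_pos_pos zero_less_numeral)
  obtain K2 :: nat where K2: "\<And>K. K2 \<le> K \<Longrightarrow> C0 / \<delta> ^ g \<le> exp (\<eta> * real K)"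
    using exp_eventually_ge[of "\<eta>"] \<eta> by meson
  have exp_ab: "exp (- \<beta>) = \<mu> * exp (- \<eta>)"
    using \<mu> by (simp add: \<beta> exp_add exp_minus exp_diff divide_inverse)
  have \<beta>0: "0 \<le> \<beta>"
  proof -
    have "ln \<mu> < 0" using \<mu> by simp
    then show ?thesis using \<eta> by (simp add: \<beta>)
  qed
  have \<alpha>0: "0 \<le> \<alpha>"
  proof -
    have "p powr (1 / (1 - \<mu>)) \<le> 1" using p \<mu> by (intro powr_le1) auto
    then have "(1 - \<mu>) * p powr (1 / (1 - \<mu>)) * exp (- \<eta>) \<le> 1 * 1 * 1"
      using \<mu> \<eta> p by (intro mult_mono) auto
    then have "exp (- \<alpha>) \<le> 1" using \<alpha>(2) by linarith
    then show ?thesis by simp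
  qed
  show ?thesis
  proof (intro exI[of _ "max 1 (max K1 K2)"] allI impI)
    fix K l :: nat and red :: "'a \<Rightarrow> 'a \<Rightarrow> bool" and V
    assume K: "max 1 (max K1 K2) \<le> K" and l: "1 \<le> l" "l \<le> K" and "red_graph red" and fin: "finite V"
      and deg: "\<forall>v\<in>V. (p + \<delta>) * card V \<le> card (red_graph.rednb red V v)"
      and large: "\<alpha> * K + \<beta> * l - l * ln y + 2 * \<eta> * K \<le> 2 * ln (card V)"
    interpret red_graph red by fact
    define N where "N = real (card V)"
    have lny: "0 \<le> - (l * ln y)"
      using xy l by (simp add: mult_nonneg_nonpos)
    have V0: "V \<noteq> {}"
    proof
      assume "V = {}"
      then have "\<alpha> * K + \<beta> * l - l * ln y + 2 * \<eta> * K \<le> 0" using large by simp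
      moreover have "0 \<le> \<alpha> * K" "0 \<le> \<beta> * l" "0 < 2 * \<eta> * K" using \<alpha>0 \<beta>0 \<eta> K by auto
      ultimately show False using lny by linarith
    qed
    then have Npos: "0 < N" using fin by (simp add: N_def card_gt_0_iff)
    show "has_red K V \<or> has_blue l V"
    \<comment> \<open>For larger \<open>V\<close> Erdos-Szekeres suffices, as
      \<open>l \<le> K\<close>. Otherwise the product of the two sizes is at most
      \<open>U = 16 ^ K\<close>.\<close>
    proof (cases "4 ^ K \<le> N")
      case True
      have "(K + l) choose l \<le> 2 ^ (K + l)" by (rule binomial_le_pow2)
      also have "\<dots> \<le> (2::nat) ^ (2 * K)" using l by (intro power_increasing) auto
      also have "\<dots> = 4 ^ K" by (simp add: power_mult)
      also have "\<dots> \<le> card V" using True by (metis N_def of_nat_le_iff of_nat_numeral of_nat_power)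
      finally show ?thesis using erdos_szekeres fin by blast
    next
      case False
      define Z where "Z = exp (\<eta> * K)"
      define U :: real where "U = 16 ^ K"
      define w where "w = (K + m) choose m"
      define Q where "Q = Z * C0 * exp (- (l * ln y))"
      have wC1: "w \<le> C1 * exp (\<eta> / 4 * K)"
        using binomial_le_exp[of "\<eta> / 4" K m] \<eta>
        by (simp add: w_def C1_def distrib_left add_divide_distrib exp_add mult_ac)
      have exp_small: "(2 * C1 / p + 1) \<le> \<zeta> * exp (\<eta> / 4 * K)"
        using K1[of K] K \<zeta> by (simp add: pos_divide_le_eq mult.commute)
      have "has_red K (V \<union> V) \<or> has_blue l V \<or> has_blue l V"
      proof (rule book_induction[OF p \<mu> \<eta> g(1) \<kappa>_def g(2-4) \<zeta>(2) \<alpha>0 \<alpha>(2) \<beta>0 _ b1 m b2, where Q = Q and Z = Z and U = U and w = w])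
        show "exp (- \<beta>) \<le> \<mu> * exp (- \<eta>)" by (simp add: exp_ab)
        have "1 * 1 * 1 \<le> Q" unfolding Q_def using C0 \<eta> lny by (intro mult_mono) (auto simp: Z_def)
        then show "1 \<le> Q" by simp
        show "0 < Z" by (simp add: Z_def)
        show "has_red K A \<or> has_blue m A" if "finite A" "w \<le> card A" for A
          using that erdos_szekeres by (simp add: w_def)
        show "has_red k A \<or> has_blue l A"
          if A: "finite A" "k \<le> K" "Q * exp (\<alpha> * k) / Z \<le> card A" for k A
        proof (cases "k = 0")
          case False
          have QA: "C0 * (exp (\<alpha> * k) * exp (- (l * ln y))) \<le> card A"
            using A(3) by (simp add: Q_def Z_def mult_ac)
          have e1: "1 * 1 \<le> exp (\<alpha> * k) * exp (- (l * ln y))"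
            using \<alpha>0 lny by (intro mult_mono) auto
          have "real (ramsey_number k l) \<le> card A"
          proof (cases "N0 \<le> k + l")
            case True
            have "real (ramsey_number k l) \<le> x powi (- int k) * y powi (- int l)"
              using region False l True by simp
            also have "\<dots> = exp (- ln x * k) * exp (- (l * ln y))"
              using xy by (simp add: powi_minus_eq_exp mult.commute)
            also have "\<dots> \<le> exp (\<alpha> * k) * exp (- (l * ln y))"
              using mult_right_mono[OF \<alpha>(1), of "real k"] by (intro mult_right_mono) auto
            also have "\<dots> \<le> C0 * (exp (\<alpha> * k) * exp (- (l * ln y)))"
              using C0 by simp
            finally show ?thesis using QA by linarith
          next
            case False
            have "real (ramsey_number k l) \<le> 2 ^ (k + l)" by (rule ramsey_number_le_two_power)
            also have "\<dots> \<le> C0" unfolding C0_def using False by (intro power_increasing) auto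
            also have "\<dots> \<le> C0 * (exp (\<alpha> * k) * exp (- (l * ln y)))"
              using C0 e1 by simp
            finally show ?thesis using QA by linarith
          qed
          then show ?thesis using ramsey_number_clique[OF A(1)] by simp
        qed simp
        show "w < n \<and> w / ((n - w) * e * p) + 1 / (n * e) \<le> \<zeta>"
          if n: "Z \<le> n" and e: "0 < e" "1 \<le> U * e ^ g" for n e :: real
        proof -
          \<comment> \<open>All errors are compared in this unit: \<open>Z = E ^ 4\<close>,
            \<open>n * e \<ge> E\<^sup>2\<close> and \<open>w \<le> C1 * E\<close>, so the total
            error is at most \<open>(2 * C1 / p + 1) / E\<close>.\<close>
          define E where "E = exp (\<eta> / 4 * K)"
          have E: "0 < E" "1 \<le> E" using \<eta> by (auto simp: E_def)
          have "exp (- (\<eta> / 2 * K)) ^ g = exp (- (K * (\<eta> * g / 2)))"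
            by (simp add: mult_ac flip: exp_of_nat_mult)
          also have "\<dots> \<le> exp (- (K * ln 16))"
            using mult_left_mono[of "ln 16" "\<eta> * g / 2" "real K"] g(5) by simp
          also have "\<dots> = 1 / U"
            by (simp add: U_def exp_minus exp_of_nat_mult divide_inverse)
          also have "\<dots> \<le> e ^ g"
            using e by (simp add: U_def field_simps)
          finally have "exp (- (\<eta> / 2 * K)) \<le> e"
            using g(1) e by (simp add: power_mono_iff)
          then have "Z * exp (- (\<eta> / 2 * K)) \<le> n * e"
            using n by (intro mult_mono) (auto simp: Z_def intro: order_trans[OF exp_ge_zero])
          moreover have "Z * exp (- (\<eta> / 2 * K)) = E * E"
            by (simp add: Z_def E_def flip: exp_add)
          ultimately have ne: "E * E \<le> n * e" by simp
          have EE: "0 < E * E" using E by simp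
          then have ne0: "0 < n * e" using ne by linarith
          have n0: "0 < n" using ne0 e by (simp add: zero_less_mult_iff)
          have wE: "w \<le> C1 * E" using wC1 by (simp add: E_def)
          have CE: "2 * C1 / p + 1 \<le> \<zeta> * E" using exp_small by (simp add: E_def)
          have "2 * C1 \<le> 2 * C1 / p" using C1 p by (simp add: pos_le_divide_eq)
          also have "\<dots> \<le> \<zeta> * E" using CE by simp
          also have "\<dots> \<le> 1 * E" using \<zeta> E by (intro mult_right_mono) auto
          finally have "2 * C1 * E \<le> E * E" using E by simp
          also have "\<dots> \<le> (E * E) * (E * E)"
          proof -
            have "1 * 1 \<le> E * E" using E by (intro mult_mono) auto
            then show ?thesis using mult_left_mono[of 1 "E * E" "E * E"] EE by simp
          qed
          also have "\<dots> = Z" by (simp add: Z_def E_def flip: exp_add)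
          finally have "2 * real w \<le> n" using wE n by linarith
          then have wn: "real w < n" "n / 2 \<le> n - w" using n0 by linarith+
          have "w / ((n - w) * e * p) \<le> (C1 * E) / ((n / 2) * e * p)"
            using wn wE C1 E e p n0 by (intro frac_le mult_right_mono mult_pos_pos) auto
          also have "\<dots> = (2 * C1 / p) * E / (n * e)"
            using e p n0 by (simp add: field_simps)
          also have "\<dots> \<le> (2 * C1 / p) * E / (E * E)"
            using ne EE C1 p E by (intro divide_left_mono) (auto intro: mult_pos_pos ne0)
          also have "\<dots> = (2 * C1 / p) / E" using E by simp
          finally have t1: "w / ((n - w) * e * p) \<le> (2 * C1 / p) / E" .
          have "1 / (n * e) \<le> 1 / (E * E)" using ne EE by (intro frac_le) auto
          also have "\<dots> \<le> 1 / E" using E by (intro frac_le) auto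
          finally have "w / ((n - w) * e * p) + 1 / (n * e) \<le> (2 * C1 / p + 1) / E"
            using t1 by (simp add: add_divide_distrib)
          also have "\<dots> \<le> \<zeta>" using CE E by (simp add: pos_divide_le_eq)
          finally show ?thesis using wn by simp
        qed
        show "real (card V) * card V \<le> U"
        proof -
          have "N * N \<le> 4 ^ K * 4 ^ K" using False Npos by (intro mult_mono) auto
          then show ?thesis by (simp add: U_def N_def flip: power_mult_distrib)
        qed
        have re: "\<delta> \<le> rel_excess p V V"
          using fin V0 deg by (intro rel_excess_geI) (auto simp: algebra_simps)
        then show "0 < rel_excess p V V" using \<delta> by linarith
        have "C0 \<le> exp (\<eta> * K) * \<delta> ^ g"
          using K2[of K] K \<delta> by (simp add: pos_divide_le_eq)
        then have "Q * exp (\<alpha> * K + \<beta> * l) \<le>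
            Z * (exp (\<eta> * K) * \<delta> ^ g) * exp (- (l * ln y)) * exp (\<alpha> * K + \<beta> * l)"
          unfolding Q_def by (intro mult_mono mult_left_mono mult_right_mono) (auto simp: Z_def \<delta> less_imp_le)
        also have "\<dots> = (exp (\<eta> * K) * exp (\<eta> * K) * exp (- (l * ln y)) * exp (\<alpha> * K + \<beta> * l)) * \<delta> ^ g"
          by (simp add: Z_def mult_ac)
        also have "exp (\<eta> * K) * exp (\<eta> * K) * exp (- (l * ln y)) * exp (\<alpha> * K + \<beta> * l) =
            exp (\<alpha> * K + \<beta> * l - l * ln y + 2 * \<eta> * K)"
          by (simp add: algebra_simps flip: exp_add)
        also have "exp (\<alpha> * K + \<beta> * l - l * ln y + 2 * \<eta> * K) * \<delta> ^ g \<le> exp (2 * ln N) * \<delta> ^ g"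
          using large \<delta> by (intro mult_right_mono) (auto simp: N_def)
        also have "exp (2 * ln N) = N * N"
          using Npos by (simp add: exp_double power2_eq_square)
        also have "N * N * \<delta> ^ g \<le> N * N * rel_excess p V V ^ g"
          using re \<delta> Npos by (intro mult_left_mono power_mono) auto
        finally show "Q * exp (\<alpha> * K + \<beta> * l) \<le> real (card V) * card V * rel_excess p V V ^ g"
          by (simp add: N_def)
      qed (use fin in auto)
      then show ?thesis by auto
    qed
  qed
qed

subsection \<open>Induction on the blue clique size\<close>

text \<open>The first derivative in the smoothness witness is itself differentiable, hence
  continuous. It agrees with \<open>F'\<close> because derivatives within \<open>{0<..1}\<close> are
  unique, each point being a limit point.\<close>

lemma smooth_on_continuous_derivative:
  assumes "smooth_on {0<..1} F"
    and der: "\<And>t. t \<in> {0<..1} \<Longrightarrow> (F has_real_derivative F' t) (at t within {0<..1})"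
  shows "continuous_on {0<..1} F'"
proof -
  obtain D where D0: "\<And>t. t \<in> {0<..1} \<Longrightarrow> D 0 t = F t"
    and D: "\<And>n t. t \<in> {0<..1} \<Longrightarrow> (D n has_real_derivative D (Suc n) t) (at t within {0<..1})"
    using assms(1) unfolding smooth_on_def by blast
  have "continuous_on {0<..1} (D 1)"
    by (rule DERIV_continuous_on[of _ _ "D 2"]) (metis D One_nat_def Suc_1)
  moreover have "D 1 t = F' t" if t: "t \<in> {0<..1}" for t
  proof -
    have "(D 0 has_real_derivative F' t) (at t within {0<..1})"
      by (rule has_field_derivative_transform_within[OF der[OF t] zero_less_one t]) (simp add: D0)
    moreover have "t / 2 \<in> {0<..1}" "t / 2 \<noteq> t"
      using t by auto
    then have "{0<..1} \<noteq> {u}" for u :: real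
      using t by (metis singletonD)
    then have "t islimpt {0<..1}"
      using t by (intro connected_imp_perfect) auto
    then have "at t within {0<..1} \<noteq> bot"
      by (simp add: trivial_limit_within)
    ultimately show ?thesis
      using D[OF t, of 0] has_field_derivative_unique by (metis One_nat_def)
  qed
  ultimately show ?thesis
    by (rule continuous_on_eq)
qed

text \<open>The region is a closure, so its points need not satisfy the Ramsey bound themselves. A
  nearby pair that does costs only \<open>\<sigma>\<close> in each logarithm.\<close>

lemma ramsey_regionE:
  assumes "(X, Y) \<in> ramsey_region" "0 < X" "0 < Y" "0 < \<sigma>"
  obtains x y :: real and N0 :: nat where "0 < x" "0 < y" "y < 1"
    "ln X - \<sigma> \<le> ln x" "ln Y - \<sigma> \<le> ln y"
    "\<And>k l. 1 \<le> k \<Longrightarrow> 1 \<le> l \<Longrightarrow> N0 \<le> k + l \<Longrightarrow>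
      real (ramsey_number k l) \<le> x powi (- int k) * y powi (- int l)"
proof -
  \<comment> \<open>Distance below \<open>X * (1 - exp (- \<sigma>))\<close> keeps \<open>x\<close>
    above \<open>X * exp (- \<sigma>)\<close>, and likewise for \<open>y\<close>.\<close>
  define d where "d = min X Y * (1 - exp (- \<sigma>))"
  have "0 < d" using assms by (simp add: d_def)
  then obtain z where z: "z \<in> {(x, y). 0 < x \<and> x < 1 \<and> 0 < y \<and> y < 1 \<and>
     (\<exists>N0::nat. \<forall>k l. 1 \<le> k \<longrightarrow> 1 \<le> l \<longrightarrow> N0 \<le> k + l \<longrightarrow>
        real (ramsey_number k l) \<le> x powi (- int k) * y powi (- int l))}" "dist z (X, Y) < d"
    using assms(1) unfolding ramsey_region_def closure_approachable by blast
  obtain x y where xy: "z = (x, y)" by (cases z)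
  have dx: "\<bar>x - X\<bar> < d" "\<bar>y - Y\<bar> < d"
    using z(2) dist_fst_le[of z "(X, Y)"] dist_snd_le[of z "(X, Y)"] by (auto simp: xy dist_real_def)
  have key: "ln W - \<sigma> \<le> ln w" if "0 < W" "0 < w" "\<bar>w - W\<bar> < d" "d \<le> W * (1 - exp (- \<sigma>))" for w W
  proof -
    have "W * exp (- \<sigma>) \<le> w" using that by (simp add: algebra_simps)
    then have "ln (W * exp (- \<sigma>)) \<le> ln w" using that by (intro ln_mono) auto
    then show ?thesis using that by (simp add: ln_mult)
  qed
  have "d \<le> X * (1 - exp (- \<sigma>))" "d \<le> Y * (1 - exp (- \<sigma>))"
    unfolding d_def using assms by (auto intro!: mult_right_mono)
  then show ?thesis
    using that[of x y] z(1) key[of X x] key[of Y y] dx assms by (auto simp: xy)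
qed

text \<open>Without the two cliques, every blue neighbourhood has fewer than
  \<open>ramsey_number k (l - 1)\<close> vertices, roughly an \<open>exp (- F' t)\<close> fraction
  of the bound claimed for \<open>l\<close>. The red density is then close to \<open>q\<close>, and
  the strict inequality for \<open>F t\<close> leaves room for \<open>dense_graph_ramsey\<close>.
  The constants \<open>r\<close> and \<open>K\<close> depend on \<open>t\<close> but not on
  \<open>k\<close> and \<open>l\<close>.\<close>

lemma ramsey_step:
  fixes F F' :: "real \<Rightarrow> real" and \<mu> X Y t \<epsilon> :: real
  assumes F_pos: "\<And>s. s \<in> {0<..1} \<Longrightarrow> 0 < F s"
    and der: "\<And>s. s \<in> {0<..1} \<Longrightarrow> (F has_real_derivative F' s) (at s within {0<..1})"
    and cont: "continuous_on {0<..1} F'"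
    and t: "t \<in> {0<..1}" and F't: "0 < F' t"
    and \<mu>: "0 < \<mu>" "\<mu> < 1" and X: "0 < X" and Y: "0 < Y"
    and X_eq: "X = (1 - exp (- F' t)) powr (1 / (1 - \<mu>)) * (1 - \<mu>)"
    and region: "(X, Y) \<in> ramsey_region"
    and F_gt: "F t > - (1 / 2) * (ln X + t * ln \<mu> + t * ln Y)"
    and \<epsilon>: "0 < \<epsilon>"
  shows "\<exists>r>0. \<exists>K::nat. \<forall>k l. K \<le> k \<longrightarrow> 2 \<le> l \<longrightarrow> l \<le> k \<longrightarrow> \<bar>real l / real k - t\<bar> < r \<longrightarrow>
    real (ramsey_number k (l - 1)) \<le> exp ((F (real (l - 1) / real k) + \<epsilon>) * real k) \<longrightarrow>
    real (ramsey_number k l) \<le> exp ((F (real l / real k) + \<epsilon>) * real k)"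
proof -
  define q where "q = 1 - exp (- F' t)"
  define G where "G s = F s + (1 / 2) * (ln X + s * ln \<mu> + s * ln Y)" for s
  \<comment> \<open>Near \<open>t\<close>, \<open>G\<close> stays above \<open>4 * \<sigma>\<close>,
    half its value at \<open>t\<close>. After doubling this gives \<open>8 * \<sigma>\<close>, while
    the losses below total at most \<open>7 * \<sigma> / 2\<close>.\<close>
  define \<sigma> where "\<sigma> = G t / 8"
  have q: "0 < q" "q < 1" using F't by (auto simp: q_def)
  have \<sigma>: "0 < \<sigma>" using F_gt by (simp add: \<sigma>_def G_def)
  define \<eta> where "\<eta> = \<sigma> / 2"
  \<comment> \<open>The reduction from \<open>q\<close> costs \<open>exp (- \<eta>)\<close> in
    \<open>p powr (1 / (1 - \<mu>))\<close>. With the further \<open>exp (- \<eta>)\<close> required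
    for \<open>\<alpha>\<close> this makes exactly \<open>exp (- \<sigma>)\<close>.\<close>
  define p where "p = q * exp (- ((1 - \<mu>) * \<eta>))"
  \<comment> \<open>The gap \<open>q - p\<close> is split in three: for the variation of
    \<open>F'\<close>, for rounding, and for the density margin \<open>p + \<delta>\<close>.\<close>
  define \<delta> where "\<delta> = (q - p) / 3"
  have \<eta>: "0 < \<eta>" using \<sigma> by (simp add: \<eta>_def)
  have pq: "0 < p" "p < q" using q \<mu> \<eta> by (auto simp: p_def)
  have \<delta>: "0 < \<delta>" using pq by (simp add: \<delta>_def)
  define \<alpha> where "\<alpha> = - ln X + \<sigma>"
  define \<beta> where "\<beta> = - ln \<mu> + \<eta>"
  have p_powr: "p powr (1 / (1 - \<mu>)) = q powr (1 / (1 - \<mu>)) * exp (- \<eta>)"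
    using q \<mu> by (simp add: p_def powr_mult exp_powr_real)
  have \<alpha>_le: "exp (- \<alpha>) \<le> (1 - \<mu>) * p powr (1 / (1 - \<mu>)) * exp (- \<eta>)"
  proof -
    have "exp (- \<alpha>) = X * exp (- \<sigma>)"
      using X by (simp add: \<alpha>_def exp_diff exp_minus divide_inverse)
    also have "exp (- \<sigma>) = exp (- \<eta>) * exp (- \<eta>)"
      by (simp add: \<eta>_def flip: exp_add)
    finally show ?thesis by (simp add: p_powr X_eq q_def mult_ac)
  qed
  obtain x y :: real and N0 :: nat where xy: "0 < x" "0 < y" "y < 1"
    "ln X - \<sigma> \<le> ln x" "ln Y - \<sigma> \<le> ln y"
    "\<And>k l. 1 \<le> k \<Longrightarrow> 1 \<le> l \<Longrightarrow> N0 \<le> k + l \<Longrightarrow>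
      real (ramsey_number k l) \<le> x powi (- int k) * y powi (- int l)"
    using ramsey_regionE[OF region X Y \<sigma>] by metis
  have "\<exists>K0::nat. \<forall>K\<ge>K0. \<forall>l (red :: nat \<Rightarrow> nat \<Rightarrow> bool) V.
    1 \<le> l \<longrightarrow> l \<le> K \<longrightarrow> red_graph red \<longrightarrow> finite V \<longrightarrow>
    (\<forall>v\<in>V. (p + \<delta>) * card V \<le> card (red_graph.rednb red V v)) \<longrightarrow>
    \<alpha> * K + \<beta> * l - l * ln y + 2 * \<eta> * K \<le> 2 * ln (card V) \<longrightarrow>
    has_clique red K V \<or> has_clique (\<lambda>u v. \<not> red u v) l V"
    by (rule dense_graph_ramsey[OF _ _ \<mu> \<eta> \<delta> xy(1-3) xy(6) _ \<alpha>_le \<beta>_def])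
      (use pq q xy in \<open>auto simp: \<alpha>_def\<close>)
  then obtain K0 :: nat where K0: "\<And>K l (red :: nat \<Rightarrow> nat \<Rightarrow> bool) V.
    K0 \<le> K \<Longrightarrow> 1 \<le> l \<Longrightarrow> l \<le> K \<Longrightarrow> red_graph red \<Longrightarrow> finite V \<Longrightarrow>
    (\<And>v. v \<in> V \<Longrightarrow> (p + \<delta>) * card V \<le> card (red_graph.rednb red V v)) \<Longrightarrow>
    \<alpha> * K + \<beta> * l - l * ln y + 2 * \<eta> * K \<le> 2 * ln (card V) \<Longrightarrow>
    has_clique red K V \<or> has_clique (\<lambda>u v. \<not> red u v) l V"
    by meson
  have "continuous_on {0<..1} F"
    using der by (intro DERIV_continuous_on) auto
  then have "continuous_on {0<..1} G"
    unfolding G_def by (intro continuous_intros)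
  then obtain r1 where r1: "0 < r1" "\<And>s. s \<in> {0<..1} \<Longrightarrow> dist s t < r1 \<Longrightarrow> dist (G s) (G t) < 4 * \<sigma>"
    using t \<sigma> unfolding continuous_on_iff by (metis mult_pos_pos zero_less_numeral)
  have "continuous_on {0<..1} (\<lambda>s. exp (- F' s))"
    by (intro continuous_intros cont)
  then obtain r2 where r2: "0 < r2" "\<And>s. s \<in> {0<..1} \<Longrightarrow> dist s t < r2 \<Longrightarrow>
      dist (exp (- F' s)) (exp (- F' t)) < \<delta>"
    using t \<delta> unfolding continuous_on_iff by metis
  \<comment> \<open>Half of each radius is kept in reserve because the mean value point lies within
    \<open>1 / k < r\<close> of \<open>l / k\<close>.\<close>
  define r where "r = min r1 r2 / 2"
  have r: "0 < r" using r1 r2 by (simp add: r_def)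
  \<comment> \<open>Uses the factor \<open>exp (\<epsilon> * k)\<close> to survive taking the floor:
    \<open>N\<close> is still at least \<open>exp (F s * k)\<close> and at least
    \<open>1 / \<delta>\<close>.\<close>
  obtain K1 :: nat where K1: "\<And>k. K1 \<le> k \<Longrightarrow> 2 + 1 / \<delta> \<le> exp (\<epsilon> * real k)"
    using exp_eventually_ge[OF \<epsilon>] by meson
  obtain K2 :: nat where K2: "1 / r < K2"
    using reals_Archimedean2 by blast
  have main: "real (ramsey_number k l) \<le> exp ((F (real l / real k) + \<epsilon>) * real k)"
    if k: "max 1 (max K0 (max K1 K2)) \<le> k" and l: "2 \<le> l" "l \<le> k"
      and near: "\<bar>real l / real k - t\<bar> < r"
      and prev: "real (ramsey_number k (l - 1)) \<le> exp ((F (real (l - 1) / real k) + \<epsilon>) * real k)" for k l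
  proof -
    define s where "s = real l / real k"
    define s' where "s' = real (l - 1) / real k"
    have k0: "0 < real k" using k by simp
    have s: "s \<in> {0<..1}" using l k0 by (auto simp: s_def)
    have s': "0 < s'" "s' < s" using l k0 by (auto simp: s_def s'_def divide_strict_right_mono)
    have ss': "s - s' = 1 / k" using l k0 by (simp add: s_def s'_def of_nat_diff diff_divide_distrib[symmetric])
    have kr: "1 / k < r"
    proof -
      have "1 / r < real k" using K2 k by linarith
      then show ?thesis using r k0 by (simp add: field_simps)
    qed
    \<comment> \<open>As \<open>s - s' = 1 / k\<close>, lowering \<open>l\<close> by one lowers
      \<open>F (l / k) * k\<close> by exactly \<open>F' \<theta>\<close>.\<close>
    have "\<exists>\<theta>\<in>{s'<..<s}. F s - F s' = F' \<theta> * (s - s')"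
    proof (rule mvt_simple[OF s'(2)])
      fix u assume "s' \<le> u" "u \<le> s"
      then have "(F has_real_derivative F' u) (at u within {0<..1})"
        using s s' by (intro der) auto
      then have "(F has_real_derivative F' u) (at u within {s'..s})"
        by (rule DERIV_subset) (use s s' in auto)
      then show "(F has_derivative (*) (F' u)) (at u within {s'..s})"
        by (simp add: has_field_derivative_def)
    qed
    then obtain \<theta> where \<theta>: "s' < \<theta>" "\<theta> < s" "F s - F s' = F' \<theta> * (s - s')" by auto
    have "F s' * k = F s * k - F' \<theta>"
      using \<theta>(3) k0 ss' by (simp add: field_simps)
    then have Fs': "(F s' + \<epsilon>) * k = (F s + \<epsilon>) * k - F' \<theta>"
      by (simp add: algebra_simps)
    have "\<bar>s - t\<bar> < r" using near by (simp add: s_def)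
    then have dist_s: "dist s t < r1" "dist \<theta> t < r2"
      using \<theta> ss' kr r1 r2 unfolding r_def dist_real_def by linarith+
    have G_ge: "4 * \<sigma> \<le> G s"
      using r1(2)[OF s dist_s(1)] unfolding dist_real_def \<sigma>_def by linarith
    have \<theta>_le: "exp (- F' \<theta>) \<le> 1 - q + \<delta>"
    proof -
      have "\<theta> \<in> {0<..1}" using \<theta> s s' by auto
      from r2(2)[OF this dist_s(2)] show ?thesis
        unfolding dist_real_def q_def by linarith
    qed
    define E where "E = exp ((F s + \<epsilon>) * k)"
    define N where "N = nat \<lfloor>E\<rfloor>"
    have E0: "0 < E" by (simp add: E_def)
    then have NE: "real N \<le> E" "E < real N + 1" by (auto simp: N_def)
    have Fs0: "0 < F s" using F_pos[OF s] .
    have exp_ge: "2 + 1 / \<delta> \<le> exp (\<epsilon> * k)" using K1 k by simp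
    have E_eq: "E = exp (F s * k) * exp (\<epsilon> * k)"
      by (simp add: E_def distrib_right exp_add)
    have eF: "1 \<le> exp (F s * k)" using Fs0 k0 by simp
    have N_ge: "exp (F s * k) \<le> N" "1 \<le> \<delta> * N"
    proof -
      have d: "0 < 1 / \<delta>" using \<delta> by simp
      have "exp (F s * k) * (2 + 1 / \<delta>) \<le> E"
        unfolding E_eq using exp_ge by (intro mult_left_mono) auto
      moreover have "exp (F s * k) + 1 + 1 / \<delta> \<le> exp (F s * k) * (2 + 1 / \<delta>)"
      proof -
        have "1 * (1 / \<delta>) \<le> exp (F s * k) * (1 / \<delta>)"
          using eF d by (intro mult_right_mono) auto
        moreover have "exp (F s * k) * (2 + 1 / \<delta>) =
            exp (F s * k) + exp (F s * k) + exp (F s * k) * (1 / \<delta>)"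
          by (simp add: distrib_left)
        ultimately show ?thesis using eF by linarith
      qed
      ultimately have *: "exp (F s * k) + 1 / \<delta> \<le> N" using NE by linarith
      then show "exp (F s * k) \<le> N" using d by linarith
      have "1 / \<delta> \<le> N" using * eF by linarith
      then show "1 \<le> \<delta> * N" using \<delta> by (simp add: pos_divide_le_eq mult.commute)
    qed
    have ln_N: "\<alpha> * k + \<beta> * l - l * ln y + 2 * \<eta> * k \<le> 2 * ln (card {..<N})"
    proof -
      have lk: "real l = s * k" using k0 by (simp add: s_def)
      have "F s * k \<le> ln N"
        using N_ge(1) by (metis exp_gt_zero less_le_trans ln_exp ln_mono)
      moreover have "\<alpha> * k + \<beta> * l - l * ln y + 2 * \<eta> * k \<le> 2 * F s * k"
      proof -
        have "l * (- ln y) \<le> l * (- ln Y + \<sigma>)"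
          using xy by (intro mult_left_mono) auto
        then have "\<alpha> * k + \<beta> * l - l * ln y + 2 * \<eta> * k
            \<le> k * (- ln X - s * ln \<mu> - s * ln Y + 2 * \<sigma> + (3 / 2) * (\<sigma> * s))"
          unfolding lk by (simp add: \<alpha>_def \<beta>_def \<eta>_def algebra_simps)
        also have "\<dots> \<le> k * (2 * F s)"
        proof (intro mult_left_mono)
          have "\<sigma> * s \<le> \<sigma> * 1" using \<sigma> s by (intro mult_left_mono) auto
          moreover have "8 * \<sigma> - ln X - s * ln \<mu> - s * ln Y \<le> 2 * F s"
            using G_ge unfolding G_def by argo
          ultimately show "- ln X - s * ln \<mu> - s * ln Y + 2 * \<sigma> + (3 / 2) * (\<sigma> * s) \<le> 2 * F s"
            using \<sigma> by argo
        qed simp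
        finally show ?thesis by (simp add: mult_ac)
      qed
      ultimately show ?thesis by simp
    qed
    have "ramsey_number k l \<le> N"
    proof (rule ramsey_number_leI)
      fix red :: "nat \<Rightarrow> nat \<Rightarrow> bool"
      assume red: "red_graph red"
      interpret red_graph red by fact
      show "has_red k {..<N} \<or> has_blue l {..<N}"
      proof (rule ccontr)
        assume no: "\<not> ?thesis"
        have "(p + \<delta>) * card {..<N} \<le> card (rednb {..<N} v)" if v: "v \<in> {..<N}" for v
        proof -
          have "\<not> has_red k (bluenb {..<N} v)"
            using no has_clique_mono[OF _ nb_subset(2)] by blast
          moreover have "\<not> has_blue (l - 1) (bluenb {..<N} v)"
            using no has_blue_extend[OF _ v, of "l - 1"] l by auto
          ultimately have "card (bluenb {..<N} v) < ramsey_number k (l - 1)"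
            using ramsey_number_clique[of "bluenb {..<N} v"] by (meson finite_lessThan finite_nb(2) not_le)
          \<comment> \<open>The strict inequality between integers yields the \<open>+ 1\<close>
            that accounts for \<open>v\<close> itself in \<open>card_nb\<close>.\<close>
          then have "real (card (bluenb {..<N} v)) + 1 \<le> ramsey_number k (l - 1)" by simp
          also have "\<dots> \<le> exp ((F s' + \<epsilon>) * k)" using prev by (simp add: s'_def)
          also have "\<dots> = E * exp (- F' \<theta>)"
            unfolding Fs' E_def by (simp add: exp_diff exp_minus divide_inverse)
          also have "\<dots> \<le> (N + 1) * (1 - q + \<delta>)"
            using NE \<theta>_le E0 by (intro mult_mono) auto
          finally have "real (card (bluenb {..<N} v)) + 1 \<le> (N + 1) * (1 - q + \<delta>)" .
          moreover have "1 - q + \<delta> \<le> 1" using pq by (simp add: \<delta>_def)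
          moreover have "real N = real (card (rednb {..<N} v)) + card (bluenb {..<N} v) + 1"
            using card_nb[OF _ v] by simp
          moreover have "q = p + 3 * \<delta>" by (simp add: \<delta>_def field_simps)
          ultimately have "(p + 2 * \<delta>) * N - 1 \<le> card (rednb {..<N} v)"
            by (simp add: algebra_simps)
          then show ?thesis using N_ge(2) by (simp add: algebra_simps)
        qed
        then have "has_red k {..<N} \<or> has_blue l {..<N}"
          using k l red ln_N by (intro K0) auto
        then show False using no by blast
      qed
    qed
    then show ?thesis
      using NE(1) unfolding E_def s_def by linarith
  qed
  show ?thesis
    by (rule exI[of _ r], rule conjI[OF r], rule exI[of _ "max 1 (max K0 (max K1 K2))"])
      (use main in blast)
qed

text \<open>Take \<open>t\<close> proportional to \<open>\<epsilon>\<close> in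
  \<open>binomial_le_exp\<close>, then \<open>c\<close> so small that \<open>l * (- ln t)\<close> is
  at most \<open>\<epsilon> * k / 2\<close>. Because \<open>F\<close> is positive, this starts the
  final induction.\<close>

lemma ramsey_number_small_ratio:
  fixes \<epsilon> :: real
  assumes "0 < \<epsilon>"
  shows "\<exists>c\<in>{0<..1}. \<forall>k l. l \<le> k \<longrightarrow> real l \<le> c * real k \<longrightarrow>
    real (ramsey_number k l) \<le> exp (\<epsilon> * real k)"
proof -
  define t where "t = min (1 / 2) (\<epsilon> / 4)"
  have t: "0 < t" "t < 1" "2 * t \<le> \<epsilon> / 2" using assms by (auto simp: t_def)
  have lnt: "0 < - ln t" using t by simp
  define c where "c = min 1 (\<epsilon> / 2 / (- ln t))"
  have c: "c \<in> {0<..1}" "c * (- ln t) \<le> \<epsilon> / 2"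
  proof -
    show "c \<in> {0<..1}" using assms lnt by (simp add: c_def divide_pos_neg)
    have "c * (- ln t) \<le> \<epsilon> / 2 / (- ln t) * (- ln t)"
      using lnt by (intro mult_right_mono) (auto simp: c_def)
    then show "c * (- ln t) \<le> \<epsilon> / 2" using lnt by simp
  qed
  have "real (ramsey_number k l) \<le> exp (\<epsilon> * real k)" if l: "l \<le> k" "real l \<le> c * real k" for k l
  proof -
    have "real (ramsey_number k l) \<le> real ((k + l) choose l)"
      using ramsey_number_le_binomial by simp
    also have "\<dots> \<le> exp (t * real (k + l)) / t ^ l"
      using t by (intro binomial_le_exp) auto
    also have "\<dots> = exp (t * real (k + l) + l * (- ln t))"
      using t by (simp add: exp_diff exp_of_nat_mult)
    also have "\<dots> \<le> exp (\<epsilon> * real k)"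
    proof -
      have "t * real (k + l) \<le> t * (2 * real k)" using l t by (intro mult_left_mono) auto
      also have "\<dots> = 2 * t * real k" by simp
      also have "\<dots> \<le> \<epsilon> / 2 * real k" using t by (intro mult_right_mono) auto
      finally have "t * real (k + l) \<le> \<epsilon> / 2 * real k" .
      moreover have "l * (- ln t) \<le> c * real k * (- ln t)"
        using l lnt by (intro mult_right_mono) auto
      moreover have "c * (- ln t) * real k \<le> \<epsilon> / 2 * real k"
        using c by (intro mult_right_mono) auto
      ultimately have "t * real (k + l) + l * (- ln t) \<le> \<epsilon> * real k"
        by (simp add: algebra_simps)
      then show ?thesis by simp
    qed
    finally show ?thesis .
  qed
  then show ?thesis using c(1) by blast
qed

theorem theorem4p1:
  fixes F F' M X Y :: "real \<Rightarrow> real"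
  assumes "F \<in> {0<..1} \<rightarrow> {0<..}"
    and "smooth_on {0<..1} F"
    and "M \<in> {0<..1} \<rightarrow> {0<..<1}"
    and "X \<in> {0<..1} \<rightarrow> {0<..<1}"
    and "Y \<in> {0<..1} \<rightarrow> {0<..<1}"
    and "\<And>t. t \<in> {0<..1} \<Longrightarrow> (F has_real_derivative F' t) (at t within {0<..1})"
    and "\<And>t. t \<in> {0<..1} \<Longrightarrow> F' t > 0"
    and "\<And>t. t \<in> {0<..1} \<Longrightarrow> X t = (1 - exp (- F' t)) powr (1 / (1 - M t)) * (1 - M t)"
    and "\<And>t. t \<in> {0<..1} \<Longrightarrow> (X t, Y t) \<in> ramsey_region"
    and "\<And>t. t \<in> {0<..1} \<Longrightarrow> F t > - (1 / 2) * (ln (X t) + t * ln (M t) + t * ln (Y t))"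
  shows "\<forall>\<epsilon>>0. \<exists>K::nat. \<forall>k l. K \<le> k \<longrightarrow> 1 \<le> l \<longrightarrow> l \<le> k \<longrightarrow>
           real (ramsey_number k l) \<le> exp ((F (real l / real k) + \<epsilon>) * real k)"
proof (intro allI impI)
  fix \<epsilon> :: real
  assume \<epsilon>: "0 < \<epsilon>"
  define bnd where "bnd k l \<longleftrightarrow> real (ramsey_number k l) \<le> exp ((F (real l / real k) + \<epsilon>) * real k)" for k l
  have F_pos: "0 < F s" if "s \<in> {0<..1}" for s
    using assms(1) that by auto
  have "\<forall>t\<in>{0<..1}. \<exists>r K. 0 < r \<and> (\<forall>k l. (K::nat) \<le> k \<longrightarrow> 2 \<le> l \<longrightarrow> l \<le> k \<longrightarrow>
      \<bar>real l / real k - t\<bar> < r \<longrightarrow> bnd k (l - 1) \<longrightarrow> bnd k l)"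
  proof
    fix t :: real
    assume t: "t \<in> {0<..1}"
    have "0 < M t" "M t < 1" "0 < X t" "0 < Y t"
      using assms(3-5) t by (auto simp: Pi_iff)
    from ramsey_step[OF F_pos assms(6) smooth_on_continuous_derivative[OF assms(2,6)] t assms(7)[OF t]
        this assms(8)[OF t] assms(9)[OF t] assms(10)[OF t] \<epsilon>]
    show "\<exists>r K. 0 < r \<and> (\<forall>k l. (K::nat) \<le> k \<longrightarrow> 2 \<le> l \<longrightarrow> l \<le> k \<longrightarrow>
      \<bar>real l / real k - t\<bar> < r \<longrightarrow> bnd k (l - 1) \<longrightarrow> bnd k l)"
      unfolding bnd_def by blast
  qed
  then obtain r :: "real \<Rightarrow> real" and K :: "real \<Rightarrow> nat" where r: "\<And>t. t \<in> {0<..1} \<Longrightarrow> 0 < r t"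
    and step: "\<And>t k l. t \<in> {0<..1} \<Longrightarrow> K t \<le> k \<Longrightarrow> 2 \<le> l \<Longrightarrow> l \<le> k \<Longrightarrow>
      \<bar>real l / real k - t\<bar> < r t \<Longrightarrow> bnd k (l - 1) \<Longrightarrow> bnd k l"
    by metis
  obtain c where c: "c \<in> {0<..1}"
    and base: "\<And>k l. l \<le> k \<Longrightarrow> real l \<le> c * real k \<Longrightarrow> real (ramsey_number k l) \<le> exp (\<epsilon> * real k)"
    using ramsey_number_small_ratio[OF \<epsilon>] by blast
  \<comment> \<open>Away from \<open>0\<close> the ratios \<open>l / k\<close> lie in a compact
    interval, so finitely many of the local steps suffice, with a common threshold for
    \<open>k\<close>.\<close>
  have "{c..1} \<subseteq> (\<Union>t\<in>{c..1}. ball t (r t))"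
  proof
    fix t assume t: "t \<in> {c..1}"
    then have "t \<in> ball t (r t)" using r c by simp
    then show "t \<in> (\<Union>t\<in>{c..1}. ball t (r t))" using t by blast
  qed
  then obtain T where T: "T \<subseteq> {c..1}" "finite T" "{c..1} \<subseteq> (\<Union>t\<in>T. ball t (r t))"
    by (rule compactE_image[OF compact_Icc open_ball])
  \<comment> \<open>Guarantees \<open>l \<ge> 2\<close> as soon as \<open>l > c * k\<close>, as the
    induction step requires.\<close>
  obtain K1 :: nat where K1: "2 / c < K1"
    using reals_Archimedean2 by blast
  have "bnd k l" if k: "max K1 (\<Sum>t\<in>T. K t) \<le> k" and l: "1 \<le> l" "l \<le> k" for k l
    \<comment> \<open>With \<open>k\<close> fixed, ratios up to \<open>c\<close> are covered
      directly and larger ones by the local step from \<open>l - 1\<close>. The sum of the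
      \<open>K t\<close> serves as a bound for each of them.\<close>
    using l
  proof (induction l rule: less_induct)
    case (less l)
    have k0: "0 < real k" using less.prems by simp
    have s: "real l / real k \<in> {0<..1}" using less.prems k0 by auto
    show ?case
    proof (cases "real l \<le> c * real k")
      case True
      have "real (ramsey_number k l) \<le> exp (\<epsilon> * real k)"
        using base less.prems True by blast
      also have "\<dots> \<le> exp ((F (real l / real k) + \<epsilon>) * real k)"
        using F_pos[OF s] by (simp add: mult_right_mono)
      finally show ?thesis by (simp add: bnd_def)
    next
      case False
      have "2 / c < real k" using K1 k by linarith
      then have "2 < c * real k" using c by (simp add: field_simps)
      then have l2: "2 \<le> l" using False by linarith
      have "real l / real k \<in> {c..1}" using False less.prems k0 by (auto simp: field_simps)
      then obtain t where t: "t \<in> T" "dist t (real l / real k) < r t"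
        using T(3) by auto
      have "K t \<le> (\<Sum>t\<in>T. K t)" using t T(2) by (intro member_le_sum) auto
      then have "K t \<le> k" using k by linarith
      moreover have "t \<in> {0<..1}" using t T(1) c by auto
      moreover have "bnd k (l - 1)" using less.IH[of "l - 1"] l2 less.prems by auto
      ultimately show ?thesis
        using step[of t k l] t l2 less.prems by (simp add: dist_real_def abs_minus_commute)
    qed
  qed
  then show "\<exists>K::nat. \<forall>k l. K \<le> k \<longrightarrow> 1 \<le> l \<longrightarrow> l \<le> k \<longrightarrow>
      real (ramsey_number k l) \<le> exp ((F (real l / real k) + \<epsilon>) * real k)"
    unfolding bnd_def by blast
qed

end
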